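(* Let $v,\epsilon,\eta>0$ be constants and let $\phi=\phi(t,x)$ be any smooth function. For $i\in\{1,2\}$ let $E^i_{\delta t,\delta x,A}$ denote the local (truncation) error of the explicit finite difference scheme with time step $\delta t$, space step $\delta x$ and discrete nonlocal operator $\mathcal{I}^{i}_{\delta x}$ truncated at length $A$, as defined in the context. The local error satisfies: (1) for $\mathcal{I}^1_{\delta x}$, $$|E^1_{\delta t,\delta x,A}|\le \mathcal{O}(\delta t)+\mathcal{O}(\delta x^{2/3})+\mathcal{O}(A^{-1/3})+\mathcal{O}\left(A^{-1/3}\,\delta x\right)+\mathcal{O}\left(A^{2/3}\,\delta x^2\right);$$ (2) for $\mathcal{I}^2_{\delta x}$, $$|E^2_{\delta t,\delta x,A}|\le \mathcal{O}(\delta t)+\mathcal{O}(\delta x^{2/3})+\mathcal{O}(A^{-1/3})+\mathcal{O}\left(A^{-4/3}\,\delta x\right)+\mathcal{O}\left(A^{2}\,\delta x^{3}\right)+\mathcal{O}\left(A\,\delta x^2\right).$$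
   Context: Grid: the computational domain is $[0,T]\times[0,D]$, with $\delta t=T/N_{\delta t}$ and $\delta x=D/N_{\delta x}$ for some integers $N_{\delta t},N_{\delta x}$; $t^n=n\,\delta t$, $x_m=m\,\delta x$, and $\phi^n_j=\phi(t^n,j\,\delta x)$. Continuous operator: $P\phi=\phi_t+v\,\phi_x-\epsilon\,\phi_{xx}+\eta\,\mathcal{I}[\phi]$, where $\mathcal{I}$ acts in the variable $x$ by $$\mathcal{I}[\varphi](x)=\int_0^{+\infty}|\xi|^{-1/3}\varphi''(x-\xi)\,d\xi=\frac49\int_{-\infty}^0\frac{\varphi(x+z)-\varphi(x)-\varphi'(x)z}{|z|^{7/3}}\,dz .$$ Discrete operators: the nonlocal term is discretized by one of the following sums, truncated at $A_{\delta x}$ terms, where $A=A_{\delta x}\,\delta x$ is the truncation parameter: $$\mathcal{I}^{1}_{\delta x}[\varphi]_{m}=\delta x^{-4/3}\sum_{l=1}^{A_{\delta x}}l^{-1/3}\left(\varphi_{m-l+1}-2\varphi_{m-l}+\varphi_{m-l-1}\right),$$ $$\mathcal{I}^{2}_{\delta x}[\varphi]_{m}=\frac49\,\delta x^{-4/3}\sum_{l=1}^{A_{\delta x}}l^{-7/3}\left(\varphi_{m-l}-\varphi_{m}+l\,\frac{\varphi_{m+1}-\varphi_{m-1}}{2}\right).$$ For $i=1,2$, $$P^i_{\delta t,\delta x}\phi=\frac{\phi_m^{n+1}-\phi_m^n}{\delta t}+v\,\frac{\phi^n_m-\phi^n_{m-1}}{\delta x}-\epsilon\,\frac{\phi^n_{m+1}-2\phi^n_m+\phi^n_{m-1}}{\delta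 x^2}+\eta\,\mathcal{I}^i_{\delta x}[\phi^n]_m,$$ and the local error at the grid point $(t^n,x_m)$ is $E^i_{\delta t,\delta x,A}=P\phi(t^n,x_m)-P^i_{\delta t,\delta x}\phi$.
   Formalization: "Any smooth function" is restricted to smooth functions on the plane whose x-derivatives of orders 1 to 4 are bounded on [0,T]×(-∞,D]; without a growth condition the nonlocal integral can diverge (e.g. φ = x²). *)

theory Defs
  imports "HOL-Analysis.Analysis"
begin

definition pd_t :: "(real \<Rightarrow> real \<Rightarrow> real) \<Rightarrow> real \<Rightarrow> real \<Rightarrow> real" where
  "pd_t \<phi> t x = deriv (\<lambda>s. \<phi> s x) t"

definition pd_x :: "(real \<Rightarrow> real \<Rightarrow> real) \<Rightarrow> real \<Rightarrow> real \<Rightarrow> real" where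
  "pd_x \<phi> t x = deriv (\<lambda>y. \<phi> t y) x"

primrec C_k :: "nat \<Rightarrow> (real \<Rightarrow> real \<Rightarrow> real) \<Rightarrow> bool" where
  "C_k 0 \<phi> \<longleftrightarrow> continuous_on UNIV (\<lambda>(t, x). \<phi> t x)"
| "C_k (Suc k) \<phi> \<longleftrightarrow>
     continuous_on UNIV (\<lambda>(t, x). \<phi> t x) \<and>
     (\<forall>t x. (\<lambda>s. \<phi> s x) differentiable (at t)) \<and>
     (\<forall>t x. (\<lambda>y. \<phi> t y) differentiable (at x)) \<and>
     C_k k (pd_t \<phi>) \<and> C_k k (pd_x \<phi>)"

definition smooth :: "(real \<Rightarrow> real \<Rightarrow> real) \<Rightarrow> bool" where
  "smooth \<phi> \<longleftrightarrow> (\<forall>k. C_k k \<phi>)"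

(* The nonlocal term at x <= D looks at the whole half-line (-infinity, x], so smoothness
   alone gives neither its convergence nor finite O-constants.  Orders 1 to 4 are the ones
   occurring in the tail estimate and in the Taylor expansions of the differences. *)
definition bounded_x_derivs :: "real \<Rightarrow> real \<Rightarrow> (real \<Rightarrow> real \<Rightarrow> real) \<Rightarrow> bool" where
  "bounded_x_derivs T D \<phi> \<longleftrightarrow>
     (\<forall>k\<in>{1..4}. bounded ((\<lambda>(t, x). (pd_x ^^ k) \<phi> t x) ` ({0..T} \<times> {..D})))"

(* The Henstock-Kurzweil integral over {0..} covers improper integrals.  This is needed here:
   with f' merely bounded the integral may converge only conditionally (e.g. f = sin). *)
definition nonlocal :: "(real \<Rightarrow> real) \<Rightarrow> real \<Rightarrow> real" where
  "nonlocal f x = integral {0..} (\<lambda>\<xi>. \<bar>\<xi>\<bar> powr (-1/3) * deriv (deriv f) (x - \<xi>))"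

definition P_op :: "real \<Rightarrow> real \<Rightarrow> real \<Rightarrow> (real \<Rightarrow> real \<Rightarrow> real) \<Rightarrow> real \<Rightarrow> real \<Rightarrow> real" where
  "P_op v \<epsilon> \<eta> \<phi> t x =
     pd_t \<phi> t x + v * pd_x \<phi> t x - \<epsilon> * pd_x (pd_x \<phi>) t x + \<eta> * nonlocal (\<phi> t) x"

(* Spatial indices are integers: the stencils reach points to the left of x = 0. *)
definition grid_fun ::
    "real \<Rightarrow> real \<Rightarrow> (real \<Rightarrow> real \<Rightarrow> real) \<Rightarrow> nat \<Rightarrow> int \<Rightarrow> real" where
  "grid_fun \<delta>t \<delta>x \<phi> n j = \<phi> (real n * \<delta>t) (of_int j * \<delta>x)"

(* K is the number of terms of the truncated sums, so the truncation length is A = K * \<delta>x. *)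
definition nonlocal1 :: "nat \<Rightarrow> real \<Rightarrow> (int \<Rightarrow> real) \<Rightarrow> int \<Rightarrow> real" where
  "nonlocal1 K \<delta>x u m =
     \<delta>x powr (-4/3) *
     (\<Sum>l=1..K. real l powr (-1/3) *
        (u (m - int l + 1) - 2 * u (m - int l) + u (m - int l - 1)))"

definition nonlocal2 :: "nat \<Rightarrow> real \<Rightarrow> (int \<Rightarrow> real) \<Rightarrow> int \<Rightarrow> real" where
  "nonlocal2 K \<delta>x u m =
     4/9 * \<delta>x powr (-4/3) *
     (\<Sum>l=1..K. real l powr (-7/3) *
        (u (m - int l) - u m + real l * ((u (m + 1) - u (m - 1)) / 2)))"

definition P_scheme ::
    "(real \<Rightarrow> (int \<Rightarrow> real) \<Rightarrow> int \<Rightarrow> real) \<Rightarrow> real \<Rightarrow> real \<Rightarrow> real \<Rightarrow>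
     real \<Rightarrow> real \<Rightarrow> (nat \<Rightarrow> int \<Rightarrow> real) \<Rightarrow> nat \<Rightarrow> int \<Rightarrow> real" where
  "P_scheme I v \<epsilon> \<eta> \<delta>t \<delta>x u n m =
     (u (n + 1) m - u n m) / \<delta>t
     + v * ((u n m - u n (m - 1)) / \<delta>x)
     - \<epsilon> * ((u n (m + 1) - 2 * u n m + u n (m - 1)) / \<delta>x\<^sup>2)
     + \<eta> * I \<delta>x (u n) m"

definition local_error ::
    "(real \<Rightarrow> (int \<Rightarrow> real) \<Rightarrow> int \<Rightarrow> real) \<Rightarrow> real \<Rightarrow> real \<Rightarrow> real \<Rightarrow>
     real \<Rightarrow> real \<Rightarrow> (real \<Rightarrow> real \<Rightarrow> real) \<Rightarrow> nat \<Rightarrow> int \<Rightarrow> real" where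
  "local_error I v \<epsilon> \<eta> \<delta>t \<delta>x \<phi> n m =
     P_op v \<epsilon> \<eta> \<phi> (real n * \<delta>t) (of_int m * \<delta>x)
     - P_scheme I v \<epsilon> \<eta> \<delta>t \<delta>x (grid_fun \<delta>t \<delta>x \<phi>) n m"

end

theory Submission
  imports Defs
begin

text \<open>
  Fix \<open>t\<close> and \<open>x = m \<delta>x\<close>, write \<open>h = \<delta>x\<close>, and let \<open>F(s) = f(x - s) - f(x) + f'(x) s\<close> with
  \<open>f = \<phi>(t, \<cdot>)\<close>, so that \<open>F(0) = F'(0) = 0\<close> and the nonlocal term is the integral of
  \<open>s^(-1/3) F''(s)\<close> over \<open>s \<ge> 0\<close>.  The parts of this
  integral over \<open>[0, h]\<close> and \<open>[A, \<infinity>)\<close> are \<open>O(h^(2/3))\<close> and \<open>O(A^(-1/3))\<close>, the latter after one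
  integration by parts.  On \<open>[h, A]\<close>, summation by parts in the first discrete operator matches
  integration by parts in the integral, because \<open>(l h)^(-1/3) - ((l + 1) h)^(-1/3)\<close> is exactly the
  integral of \<open>1/3 s^(-4/3)\<close> over a cell; the second operator is a rectangle rule for
  \<open>4/9 s^(-7/3) F(s)\<close>, whose derivative is \<open>O(s^(-4/3))\<close>.  In both cases the error on a cell is at most
  a multiple of \<open>h\<close> times the increment of \<open>s^(-1/3)\<close>, so the errors telescope to \<open>O(h^(2/3))\<close>.
  Hence both schemes satisfy the stronger bound \<open>O(\<delta>t) + O(h^(2/3)) + O(A^(-1/3))\<close>.
\<close>

subsection \<open>Improper integrals and powers\<close>

text \<open>On an unbounded set the integral is tested on all boxes containing a large ball. For the
  extension of \<open>f\<close> by zero, such a box \<open>{c..d}\<close> has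
  \<open>c \<le> a\<close>, so only \<open>{a..d}\<close> with \<open>d\<close> large contributes.
  Absolute convergence never enters.\<close>

lemma has_integral_at_topI:
  fixes f :: "real \<Rightarrow> real"
  assumes int: "\<And>b. f integrable_on {a..b}"
    and lim: "((\<lambda>b. integral {a..b} f) \<longlongrightarrow> I) at_top"
  shows "(f has_integral I) {a..}"
proof -
  let ?g = "\<lambda>x. if x \<in> {a..} then f x else 0"
  have eq: "(?g has_integral J) {c..d} \<longleftrightarrow> (f has_integral J) {max a c..d}" for c d J
  proof -
    have "(\<lambda>x. if x \<in> {max a c..d} then f x else 0) = (\<lambda>x. if x \<in> {c..d} then ?g x else 0)"
      by auto
    then show ?thesis
      using has_integral_restrict_UNIV[of "{max a c..d}" f J]
        has_integral_restrict_UNIV[of "{c..d}" ?g J] by simp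
  qed
  have int': "f integrable_on {max a c..d}" for c d
    by (rule integrable_on_subinterval[OF int[of d]]) auto
  have "?g integrable_on cbox c d" for c d
    using int'[of c d] eq[of _ c d] unfolding integrable_on_def by auto
  moreover have "\<exists>B>0. \<forall>c d. ball 0 B \<subseteq> cbox c d \<longrightarrow> norm (integral (cbox c d) ?g - I) < e"
    if "e > 0" for e
  proof -
    have "eventually (\<lambda>b. dist (integral {a..b} f) I < e) at_top"
      using lim that by (rule tendstoD)
    then obtain N where N: "\<And>b. b \<ge> N \<Longrightarrow> dist (integral {a..b} f) I < e"
      by (auto simp: eventually_at_top_linorder)
    \<comment> \<open>The extra 1 puts both points \<open>\<bar>N\<bar> + \<bar>a\<bar>\<close> and
      its negative inside the open ball; the first forces \<open>d \<ge> N\<close>, the second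
      \<open>c \<le> a\<close>.\<close>
    define B where "B = \<bar>N\<bar> + \<bar>a\<bar> + 1"
    have "norm (integral (cbox c d) ?g - I) < e" if "ball 0 B \<subseteq> cbox c d" for c d
    proof -
      have "\<bar>N\<bar> + \<bar>a\<bar> \<in> ball 0 B" "- (\<bar>N\<bar> + \<bar>a\<bar>) \<in> ball 0 B"
        by (auto simp: B_def dist_real_def)
      then have "\<bar>N\<bar> + \<bar>a\<bar> \<in> {c..d}" "- (\<bar>N\<bar> + \<bar>a\<bar>) \<in> {c..d}"
        using subsetD[OF that[unfolded cbox_interval]] by (simp_all only:)
      then have d: "d \<ge> N" "max a c = a"
        unfolding atLeastAtMost_iff by linarith+
      have "(?g has_integral integral {a..d} f) {c..d}"
        using int[of d] eq[of _ c d] d by (simp add: integrable_integral)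
      then have "integral {c..d} ?g = integral {a..d} f"
        by (rule integral_unique)
      then show ?thesis
        using N[of d] d by (simp add: dist_real_def)
    qed
    then show ?thesis
      by (intro exI[of _ B]) (auto simp: B_def)
  qed
  ultimately show ?thesis
    unfolding has_integral_alt'[of f] by blast
qed

text \<open>Vanishing tail bounds make the partial integrals Cauchy, and the bound on a finite tail
  survives the passage to the limit. Convergence may thus be merely conditional.\<close>

lemma integral_at_top_tail_bound:
  fixes f r :: "real \<Rightarrow> real"
  assumes int: "\<And>b. f integrable_on {a..b}"
    and tail: "\<And>b c. a < b \<Longrightarrow> b \<le> c \<Longrightarrow> \<bar>integral {b..c} f\<bar> \<le> r b"
    and r: "(r \<longlongrightarrow> 0) at_top"
    and b: "a < b"
  shows "\<bar>integral {a..} f - integral {a..b} f\<bar> \<le> r b"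
proof -
  have diff: "\<bar>integral {a..c} f - integral {a..b} f\<bar> \<le> r b" if "a < b" "b \<le> c" for b c
  proof -
    have "integral {a..b} f + integral {b..c} f = integral {a..c} f"
      using that by (intro Henstock_Kurzweil_Integration.integral_combine int) auto
    then show ?thesis
      using tail[OF that] by (simp add: algebra_simps)
  qed
  have "Cauchy (\<lambda>n. integral {a..real n} f)"
  proof (rule CauchyI)
    fix e :: real assume "e > 0"
    then have "eventually (\<lambda>x. dist (r x) 0 < e / 2) at_top"
      by (intro tendstoD[OF r] half_gt_zero)
    then have "eventually (\<lambda>x. dist (r x) 0 < e / 2 \<and> x > a) at_top"
      by (rule eventually_conj[OF _ eventually_gt_at_top])
    then obtain N where N: "\<And>x. x \<ge> N \<Longrightarrow> \<bar>r x\<bar> < e / 2 \<and> x > a"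
      unfolding eventually_at_top_linorder dist_real_def diff_0_right by blast
    define k where "k = nat \<lceil>N\<rceil>"
    have k: "real k \<ge> N" unfolding k_def by linarith
    have half: "\<bar>integral {a..real n} f - integral {a..real k} f\<bar> < e / 2" if "n \<ge> k" for n
    proof -
      have "\<bar>integral {a..real n} f - integral {a..real k} f\<bar> \<le> r (real k)"
        using N[OF k] that by (intro diff) auto
      then show ?thesis
        using N[OF k] by linarith
    qed
    have "norm (integral {a..real m} f - integral {a..real n} f) < e" if "m \<ge> k" "n \<ge> k" for m n
      using half[OF that(1)] half[OF that(2)] unfolding real_norm_def by linarith
    then show "\<exists>k. \<forall>m\<ge>k. \<forall>n\<ge>k. norm (integral {a..real m} f - integral {a..real n} f) < e"
      by blast
  qed
  then obtain I where I: "(\<lambda>n. integral {a..real n} f) \<longlonglongrightarrow> I"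
    unfolding Cauchy_convergent_iff convergent_def by blast
  have bound: "\<bar>I - integral {a..b} f\<bar> \<le> r b" if "a < b" for b
  proof (rule tendsto_upperbound)
    show "(\<lambda>n. \<bar>integral {a..real n} f - integral {a..b} f\<bar>) \<longlonglongrightarrow> \<bar>I - integral {a..b} f\<bar>"
      by (intro tendsto_rabs tendsto_diff tendsto_const I)
    show "eventually (\<lambda>n. \<bar>integral {a..real n} f - integral {a..b} f\<bar> \<le> r b) sequentially"
      by (rule eventually_sequentiallyI[of "nat \<lceil>b\<rceil>"], rule diff[OF that], linarith)
  qed simp
  \<comment> \<open>The limit was found along integers only; the bound \<open>r b\<close>, valid for
    every real \<open>b > a\<close>, extends it to real \<open>b\<close>.\<close>
  have "((\<lambda>b. integral {a..b} f) \<longlongrightarrow> I) at_top"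
  proof (rule Lim_transform)
    show "((\<lambda>b. I) \<longlongrightarrow> I) at_top" by simp
    have "((\<lambda>b. I - integral {a..b} f) \<longlongrightarrow> 0) at_top"
      by (rule Lim_null_comparison[OF _ r])
        (rule eventually_mono[OF eventually_gt_at_top[of a]], simp add: bound)
    then show "((\<lambda>b. integral {a..b} f - I) \<longlongrightarrow> 0) at_top"
      using tendsto_minus[of "\<lambda>b. I - integral {a..b} f" 0] by simp
  qed
  then have "integral {a..} f = I"
    by (intro integral_unique has_integral_at_topI int)
  then show ?thesis
    using bound[OF b] by simp
qed

section \<open>Integration by parts and bounds with power weights\<close>

lemma has_real_derivative_powr':
  fixes s p :: real
  assumes "s > 0"
  shows "((\<lambda>s. s powr p) has_real_derivative p * s powr (p - 1)) (at s within S)"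
  using assms by (auto intro!: derivative_eq_intros)

lemma continuous_on_powr_mult:
  fixes G :: "real \<Rightarrow> real"
  assumes "0 < a" "continuous_on {a..b} G"
  shows "continuous_on {a..b} (\<lambda>s. s powr p * G s)"
  using assms by (intro continuous_intros) auto

lemma integral_powr_by_parts:
  fixes G G' :: "real \<Rightarrow> real"
  assumes ab: "0 < a" "a \<le> b"
    and dG: "\<And>s. a \<le> s \<Longrightarrow> s \<le> b \<Longrightarrow> (G has_real_derivative G' s) (at s)"
    and cG': "continuous_on {a..b} G'"
  shows "integral {a..b} (\<lambda>s. s powr p * G' s) =
    b powr p * G b - a powr p * G a - p * integral {a..b} (\<lambda>s. s powr (p - 1) * G s)"
proof -
  have cG: "continuous_on {a..b} G"
    by (rule DERIV_continuous_on[where D = G']) (use dG in \<open>auto intro: has_field_derivative_at_within\<close>)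
  have "((\<lambda>s. s powr p * G' s + p * (s powr (p - 1) * G s)) has_integral
      b powr p * G b - a powr p * G a) {a..b}"
  proof (rule fundamental_theorem_of_calculus)
    fix s assume s: "s \<in> {a..b}"
    have "((\<lambda>s. s powr p * G s) has_real_derivative
        p * s powr (p - 1) * G s + G' s * s powr p) (at s within {a..b})"
      using ab s
      by (intro DERIV_mult has_real_derivative_powr' dG[THEN has_field_derivative_at_within]) auto
    then show "((\<lambda>s. s powr p * G s) has_vector_derivative
        s powr p * G' s + p * (s powr (p - 1) * G s)) (at s within {a..b})"
      by (simp add: has_real_derivative_iff_has_vector_derivative mult_ac add_ac)
  qed (rule ab)
  then have "integral {a..b} (\<lambda>s. s powr p * G' s + p * (s powr (p - 1) * G s)) =
      b powr p * G b - a powr p * G a"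
    by (rule integral_unique)
  moreover have "integral {a..b} (\<lambda>s. s powr p * G' s + p * (s powr (p - 1) * G s)) =
      integral {a..b} (\<lambda>s. s powr p * G' s) + p * integral {a..b} (\<lambda>s. s powr (p - 1) * G s)"
    using ab cG cG'
    by (subst Henstock_Kurzweil_Integration.integral_add)
      (simp_all add: integrable_continuous_interval continuous_on_powr_mult continuous_on_mult_left)
  ultimately show ?thesis by simp
qed

lemma has_integral_powr_minus_4_3:
  assumes "0 < a" "a \<le> b"
  shows "((\<lambda>s::real. s powr (-4/3)) has_integral 3 * (a powr (-1/3) - b powr (-1/3))) {a..b}"
proof -
  have "((\<lambda>s::real. s powr (-4/3)) has_integral
      -3 * b powr (-1/3) - (-3) * a powr (-1/3)) {a..b}"
  proof (rule fundamental_theorem_of_calculus)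
    fix s assume "s \<in> {a..b}"
    then have "((\<lambda>s. -3 * s powr (-1/3)) has_real_derivative
        -3 * (-1/3 * s powr (-1/3 - 1))) (at s within {a..b})"
      using assms by (intro DERIV_cmult has_real_derivative_powr') auto
    then show "((\<lambda>s. -3 * s powr (-1/3)) has_vector_derivative s powr (-4/3)) (at s within {a..b})"
      by (simp add: has_real_derivative_iff_has_vector_derivative)
  qed (rule assms)
  then show ?thesis by (simp add: algebra_simps)
qed

text \<open>The weight is integrated exactly, so the bound is an increment of
  \<open>s powr (-1/3)\<close> and telescopes when summed over adjacent cells.\<close>

lemma integral_powr_minus_4_3_mult_bound:
  fixes G :: "real \<Rightarrow> real"
  assumes ab: "0 < a" "a \<le> b" and c: "continuous_on {a..b} G"
    and G: "\<And>s. a \<le> s \<Longrightarrow> s \<le> b \<Longrightarrow> \<bar>G s\<bar> \<le> B"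
  shows "\<bar>integral {a..b} (\<lambda>s. s powr (-4/3) * G s)\<bar> \<le> 3 * B * (a powr (-1/3) - b powr (-1/3))"
proof -
  have i: "((\<lambda>s. s powr (-4/3) * B) has_integral (3 * (a powr (-1/3) - b powr (-1/3))) * B) {a..b}"
    by (intro has_integral_mult_left has_integral_powr_minus_4_3 ab)
  have "norm (integral {a..b} (\<lambda>s. s powr (-4/3) * G s)) \<le> integral {a..b} (\<lambda>s. s powr (-4/3) * B)"
  proof (rule integral_norm_bound_integral)
    show "(\<lambda>s. s powr (-4/3) * G s) integrable_on {a..b}"
      using ab c by (intro integrable_continuous_interval continuous_on_powr_mult)
    show "norm (s powr (-4/3) * G s) \<le> s powr (-4/3) * B" if "s \<in> {a..b}" for s
      using that G[of s] by (simp add: abs_mult mult_left_mono)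
  qed (use i in \<open>rule has_integral_integrable\<close>)
  then show ?thesis
    unfolding integral_unique[OF i] by (simp add: mult_ac)
qed

subsection \<open>The kernel integral of a function flat at the origin\<close>

text \<open>\<open>F\<close> is meant to be the first-order Taylor remainder of the profile, seen in
  the leftward distance \<open>s\<close>. The bounds are asked only for \<open>s \<ge> 0\<close>,
  the side on which the nonlocal term looks.\<close>

locale flat_at_origin =
  fixes F F1 F2 :: "real \<Rightarrow> real" and M :: real
  assumes dF: "(F has_real_derivative F1 s) (at s)"
    and dF1: "(F1 has_real_derivative F2 s) (at s)"
    and F2_continuous_UNIV: "continuous_on UNIV F2"
    and F_0: "F 0 = 0" and F1_0: "F1 0 = 0"
    and F1_le: "0 \<le> s \<Longrightarrow> \<bar>F1 s\<bar> \<le> M"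
    and F2_le: "0 \<le> s \<Longrightarrow> \<bar>F2 s\<bar> \<le> M"
begin

section \<open>Growth bounds for \<open>F\<close> and \<open>F1\<close>\<close>

lemma M_nonneg: "0 \<le> M"
  using F1_le[of 0] by simp

lemma continuous_F: "continuous_on S F"
  by (rule DERIV_continuous_on, rule has_field_derivative_at_within, rule dF)

lemma continuous_F1: "continuous_on S F1"
  by (rule DERIV_continuous_on, rule has_field_derivative_at_within, rule dF1)

lemma continuous_F2: "continuous_on S F2"
  by (rule continuous_on_subset[OF F2_continuous_UNIV]) simp

lemma F_mean_value:
  assumes "a < b"
  obtains z where "a < z" "z < b" "F b - F a = (b - a) * F1 z"
  using MVT2[OF assms dF] by blast

lemma F1_mean_value:
  assumes "a < b"
  obtains z where "a < z" "z < b" "F1 b - F1 a = (b - a) * F2 z"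
  using MVT2[OF assms dF1] by blast

lemma F1_lipschitz_le:
  assumes "0 \<le> a" "a \<le> b"
  shows "\<bar>F1 b - F1 a\<bar> \<le> M * (b - a)"
proof (cases "a = b")
  case False
  then obtain z where "a < z" "F1 b - F1 a = (b - a) * F2 z"
    using F1_mean_value[of a b] assms by (metis order_le_less)
  then show ?thesis
    using F2_le[of z] assms mult_left_mono[of "\<bar>F2 z\<bar>" M "b - a"] by (simp add: abs_mult mult.commute[of M])
qed simp

lemma F1_lipschitz:
  assumes "0 \<le> a" "0 \<le> b"
  shows "\<bar>F1 b - F1 a\<bar> \<le> M * \<bar>b - a\<bar>"
  using F1_lipschitz_le[of a b] F1_lipschitz_le[of b a] assms
  by (cases "a \<le> b") (auto simp: abs_minus_commute)

lemma F_lipschitz: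
  assumes "0 \<le> a" "a \<le> b"
  shows "\<bar>F b - F a\<bar> \<le> M * (b - a)"
proof (cases "a = b")
  case False
  then obtain z where "a < z" "F b - F a = (b - a) * F1 z"
    using F_mean_value[of a b] assms by (metis order_le_less)
  then show ?thesis
    using F1_le[of z] assms mult_left_mono[of "\<bar>F1 z\<bar>" M "b - a"] by (simp add: abs_mult mult.commute[of M])
qed simp

lemma F1_le_linear: "0 \<le> s \<Longrightarrow> \<bar>F1 s\<bar> \<le> M * s"
  using F1_lipschitz_le[of 0 s] F1_0 by simp

lemma F_le_linear: "0 \<le> s \<Longrightarrow> \<bar>F s\<bar> \<le> M * s"
  using F_lipschitz[of 0 s] F_0 by simp

text \<open>Flatness at 0 gives second-order smallness, which tames the singular powers near the
  origin. At the far end \<open>F_le_linear\<close> takes over, since there the quadratic bound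
  would grow too fast.\<close>

lemma F_le_quadratic:
  assumes "0 \<le> s"
  shows "\<bar>F s\<bar> \<le> M * s\<^sup>2"
proof (cases "s = 0")
  case False
  then obtain z where z: "0 < z" "z < s" "F s - F 0 = (s - 0) * F1 z"
    using F_mean_value[of 0 s] assms by (metis order_le_less)
  then have "\<bar>F1 z\<bar> \<le> M * s"
    using F1_le_linear[of z] mult_left_mono[of z s M] M_nonneg by linarith
  then have "s * \<bar>F1 z\<bar> \<le> s * (M * s)"
    using assms by (rule mult_left_mono)
  then show ?thesis
    using z assms F_0 by (simp add: abs_mult power2_eq_square mult_ac)
qed (simp add: F_0)

section \<open>Integration by parts and truncation of the kernel integral\<close>

definition kernel_integral :: "real \<Rightarrow> real \<Rightarrow> real" where
  "kernel_integral a b = integral {a..b} (\<lambda>s. s powr (-1/3) * F2 s)"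

lemma kernel_integral_eq1:
  assumes "0 < a" "a \<le> b"
  shows "kernel_integral a b = b powr (-1/3) * F1 b - a powr (-1/3) * F1 a
    + 1/3 * integral {a..b} (\<lambda>s. s powr (-4/3) * F1 s)"
  unfolding kernel_integral_def
  using integral_powr_by_parts[OF assms dF1 continuous_F2, of "-1/3"] by simp

text \<open>A second integration by parts, applied to the integral left in
  \<open>kernel_integral_eq1\<close>; 4/9 = 1/3 * 4/3 is the constant of the second discrete
  operator.\<close>

lemma kernel_integral_eq2:
  assumes "0 < a" "a \<le> b"
  shows "kernel_integral a b = b powr (-1/3) * F1 b - a powr (-1/3) * F1 a
    + 1/3 * (b powr (-4/3) * F b - a powr (-4/3) * F a)
    + 4/9 * integral {a..b} (\<lambda>s. s powr (-7/3) * F s)"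
  using kernel_integral_eq1[OF assms] integral_powr_by_parts[OF assms dF continuous_F1, of "-4/3"]
  by (simp add: algebra_simps)

text \<open>A bound uniform in \<open>b\<close> needs decay, which one integration by parts
  supplies: the weight becomes the integrable \<open>s powr (-4/3)\<close> against the bounded
  \<open>F1\<close>. The contributions at \<open>b\<close> cancel in the estimate.\<close>

lemma kernel_integral_bound:
  assumes "0 < a" "a \<le> b"
  shows "\<bar>kernel_integral a b\<bar> \<le> 2 * M * a powr (-1/3)"
proof -
  have "\<bar>integral {a..b} (\<lambda>s. s powr (-4/3) * F1 s)\<bar> \<le> 3 * M * (a powr (-1/3) - b powr (-1/3))"
    using assms F1_le by (intro integral_powr_minus_4_3_mult_bound continuous_F1) auto
  moreover have "\<bar>s powr (-1/3) * F1 s\<bar> \<le> M * s powr (-1/3)" if "0 < s" for s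
    using that F1_le[of s] by (simp add: abs_mult mult.commute mult_right_mono)
  from this[of a] this[of b]
  have "\<bar>a powr (-1/3) * F1 a\<bar> \<le> M * a powr (-1/3)" "\<bar>b powr (-1/3) * F1 b\<bar> \<le> M * b powr (-1/3)"
    using assms by auto
  ultimately show ?thesis
    unfolding kernel_integral_eq1[OF assms] by (simp add: algebra_simps abs_le_iff) linarith
qed

text \<open>The singularity at 0 is integrable: the integrand is measurable and dominated by
  \<open>M * s powr (-1/3)\<close>, whose integral is the stated bound.\<close>

lemma kernel_integrable:
  shows "(\<lambda>s. s powr (-1/3) * F2 s) integrable_on {0..b}"
    and "0 \<le> b \<Longrightarrow> \<bar>kernel_integral 0 b\<bar> \<le> 3/2 * M * b powr (2/3)"
proof -
  have *: "(\<lambda>s. s powr (-1/3) * F2 s) integrable_on {0..b} \<and>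
    \<bar>kernel_integral 0 b\<bar> \<le> 3/2 * M * b powr (2/3)" if "0 \<le> b" for b
  proof -
    have i: "((\<lambda>s::real. s powr (-1/3)) has_integral (b powr (2/3) / (2/3))) {0..b}"
      using has_integral_powr_from_0[of "-1/3" b] that by simp
    have ib: "((\<lambda>s. s powr (-1/3) * M) has_integral (b powr (2/3) / (2/3)) * M) {0..b}"
      by (intro has_integral_mult_left i)
    have le: "norm (s powr (-1/3) * F2 s) \<le> s powr (-1/3) * M" if "s \<in> {0..b}" for s
      using that F2_le[of s] by (simp add: abs_mult mult_left_mono)
    have m: "(\<lambda>s. s powr (-1/3) * F2 s) \<in> borel_measurable (lebesgue_on {0..b})"
    proof (intro borel_measurable_times)
      show "(\<lambda>s. s powr (-1/3)) \<in> borel_measurable (lebesgue_on {0..b})"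
        using i by (intro integrable_imp_measurable) (rule has_integral_integrable)
      show "F2 \<in> borel_measurable (lebesgue_on {0..b})"
        by (intro continuous_imp_measurable_on_sets_lebesgue continuous_F2) auto
    qed
    have int: "(\<lambda>s. s powr (-1/3) * F2 s) integrable_on {0..b}"
      by (rule measurable_bounded_by_integrable_imp_integrable[OF m has_integral_integrable[OF ib]])
        (use le in auto)
    have "norm (kernel_integral 0 b) \<le> integral {0..b} (\<lambda>s. s powr (-1/3) * M)"
      unfolding kernel_integral_def
      by (rule integral_norm_bound_integral[OF int has_integral_integrable[OF ib] le])
    then show ?thesis
      using int unfolding integral_unique[OF ib] by (simp add: mult_ac)
  qed
  show "0 \<le> b \<Longrightarrow> \<bar>kernel_integral 0 b\<bar> \<le> 3/2 * M * b powr (2/3)"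
    using * by blast
  show "(\<lambda>s. s powr (-1/3) * F2 s) integrable_on {0..b}"
    using *[of b] by (cases "0 \<le> b") auto
qed

text \<open>The two terms are the prices of dropping \<open>{0..a}\<close> and \<open>{b..}\<close>;
  later \<open>a\<close> is the mesh width and \<open>b\<close> the truncation length.\<close>

lemma half_line_integral_approx:
  assumes "0 < a" "a \<le> b"
  shows "\<bar>integral {0..} (\<lambda>s. s powr (-1/3) * F2 s) - kernel_integral a b\<bar>
    \<le> 3/2 * M * a powr (2/3) + 2 * M * b powr (-1/3)"
proof -
  have "((\<lambda>b::real. 2 * M * b powr (-1/3)) \<longlongrightarrow> 0) at_top"
    by (intro tendsto_mult_right_zero tendsto_neg_powr filterlim_ident) auto
  then have "\<bar>integral {0..} (\<lambda>s. s powr (-1/3) * F2 s) - kernel_integral 0 b\<bar> \<le> 2 * M * b powr (-1/3)"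
    unfolding kernel_integral_def using assms kernel_integral_bound[unfolded kernel_integral_def]
    by (intro integral_at_top_tail_bound kernel_integrable) auto
  moreover have "kernel_integral 0 a + kernel_integral a b = kernel_integral 0 b"
    unfolding kernel_integral_def using assms
    by (intro Henstock_Kurzweil_Integration.integral_combine kernel_integrable) auto
  ultimately show ?thesis
    using kernel_integrable(2)[of a] assms by linarith
qed

text \<open>The difference quotient is \<open>F1 z\<close> for some \<open>z\<close> in the cell,
  and the weight in front is exactly one third of the integral of \<open>s powr (-4/3)\<close>. What
  remains is the integral of that weight times \<open>F1 s - F1 z\<close>, controlled by the
  Lipschitz bound on \<open>F1\<close>.\<close>

lemma increment_cell_error:
  assumes ab: "0 < a" "a < b"
  shows "\<bar>(a powr (-1/3) - b powr (-1/3)) * ((F b - F a) / (b - a))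
      - 1/3 * integral {a..b} (\<lambda>s. s powr (-4/3) * F1 s)\<bar>
    \<le> M * (b - a) * (a powr (-1/3) - b powr (-1/3))"
proof -
  obtain z where z: "a < z" "z < b" "F b - F a = (b - a) * F1 z"
    using F_mean_value[OF ab(2)] by blast
  have le: "\<bar>F1 s - F1 z\<bar> \<le> M * (b - a)" if "a \<le> s" "s \<le> b" for s
    using F1_lipschitz[of z s] that z ab mult_left_mono[of "\<bar>s - z\<bar>" "b - a" M] M_nonneg by linarith
  have "\<bar>integral {a..b} (\<lambda>s. s powr (-4/3) * (F1 s - F1 z))\<bar>
      \<le> 3 * (M * (b - a)) * (a powr (-1/3) - b powr (-1/3))"
    using ab le by (intro integral_powr_minus_4_3_mult_bound continuous_intros continuous_F1) auto
  moreover have "integral {a..b} (\<lambda>s. s powr (-4/3) * (F1 s - F1 z)) =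
      integral {a..b} (\<lambda>s. s powr (-4/3) * F1 s) - 3 * (a powr (-1/3) - b powr (-1/3)) * F1 z"
  proof -
    have "((\<lambda>s. s powr (-4/3) * F1 z) has_integral (3 * (a powr (-1/3) - b powr (-1/3)) * F1 z)) {a..b}"
      using ab by (intro has_integral_mult_left has_integral_powr_minus_4_3) auto
    moreover have "((\<lambda>s. s powr (-4/3) * F1 s) has_integral integral {a..b} (\<lambda>s. s powr (-4/3) * F1 s)) {a..b}"
      using ab by (intro integrable_integral integrable_continuous_interval continuous_on_powr_mult continuous_F1)
    ultimately show ?thesis
      by (intro integral_unique) (simp only: right_diff_distrib has_integral_diff)
  qed
  moreover have "(F b - F a) / (b - a) = F1 z"
    using z ab by simp
  ultimately show ?thesis
    by (simp add: algebra_simps abs_le_iff)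
qed

text \<open>The derivative of \<open>s powr (-7/3) * F s\<close> is at most (7/3 + 1) * M *
  \<open>s powr (-4/3)\<close>, because \<open>F\<close> is quadratically and \<open>F1\<close>
  linearly small. Rounding 10/3 up to 4 and integrating the power gives 3 * 4 = 12; the oscillation
  on the cell is then multiplied by the cell length.\<close>

lemma rectangle_cell_error:
  assumes ab: "0 < a" "a < b"
  shows "\<bar>(b - a) * (b powr (-7/3) * F b) - integral {a..b} (\<lambda>s. s powr (-7/3) * F s)\<bar>
    \<le> 12 * M * (b - a) * (a powr (-1/3) - b powr (-1/3))"
proof -
  define G where "G = (\<lambda>s. s powr (-7/3) * F s)"
  define G1 where "G1 s = -7/3 * s powr (-7/3 - 1) * F s + F1 s * s powr (-7/3)" for s
  \<comment> \<open>\<open>H\<close> is increasing with \<open>H' \<ge> \<bar>G'\<bar>\<close>, so \<open>H - G\<close> and \<open>H + G\<close> are both increasing.\<close>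
  define H where "H s = -12 * M * s powr (-1/3)" for s
  have dG: "(G has_real_derivative G1 s) (at s)" if "0 < s" for s
    unfolding G_def G1_def using that by (intro DERIV_mult has_real_derivative_powr' dF)
  have dH: "(H has_real_derivative -12 * M * (-1/3 * s powr (-1/3 - 1))) (at s)" if "0 < s" for s
    unfolding H_def using that by (intro DERIV_cmult has_real_derivative_powr')
  have G1_le: "\<bar>G1 s\<bar> \<le> 4 * M * s powr (-4/3)" if s: "0 < s" for s
  proof -
    have p: "s powr (-7/3 - 1) * s\<^sup>2 = s powr (-4/3)" "s powr (-7/3) * s = s powr (-4/3)"
      using s powr_add[of s "-7/3 - 1" 2] powr_add[of s "-7/3" 1] by simp_all
    have "\<bar>G1 s\<bar> \<le> 7/3 * (s powr (-7/3 - 1) * \<bar>F s\<bar>) + s powr (-7/3) * \<bar>F1 s\<bar>"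
      unfolding G1_def by (rule order_trans[OF abs_triangle_ineq]) (simp add: abs_mult)
    also have "\<dots> \<le> 7/3 * (s powr (-7/3 - 1) * (M * s\<^sup>2)) + s powr (-7/3) * (M * s)"
      using F_le_quadratic[of s] F1_le_linear[of s] s
      by (intro add_mono mult_left_mono) auto
    also have "\<dots> = 7/3 * M * (s powr (-7/3 - 1) * s\<^sup>2) + M * (s powr (-7/3) * s)"
      by (simp only: mult_ac)
    also have "\<dots> = 10/3 * M * s powr (-4/3)"
      unfolding p by simp
    also have "\<dots> \<le> 4 * M * s powr (-4/3)"
      using M_nonneg by (intro mult_right_mono) auto
    finally show ?thesis .
  qed
  have diff: "\<bar>G b - G s\<bar> \<le> 12 * M * (a powr (-1/3) - b powr (-1/3))" if s: "a \<le> s" "s \<le> b" for s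
  proof -
    have dHG: "((\<lambda>s. H s - G s) has_real_derivative -12 * M * (-1/3 * s powr (-1/3 - 1)) - G1 s) (at s)"
      and dHG': "((\<lambda>s. H s + G s) has_real_derivative -12 * M * (-1/3 * s powr (-1/3 - 1)) + G1 s) (at s)"
      if "0 < s" for s
      using DERIV_diff[OF dH[OF that] dG[OF that]] DERIV_add[OF dH[OF that] dG[OF that]] by blast+
    have nn: "0 \<le> -12 * M * (-1/3 * s powr (-1/3 - 1)) - G1 s"
      "0 \<le> -12 * M * (-1/3 * s powr (-1/3 - 1)) + G1 s" if "0 < s" for s
      using G1_le[OF that] by (auto simp: abs_le_iff)
    have "H s - G s \<le> H b - G b"
    proof (rule DERIV_nonneg_imp_nondecreasing[OF s(2)])
      fix y assume "s \<le> y"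
      then have "0 < y" using ab s by linarith
      then show "\<exists>D. ((\<lambda>s. H s - G s) has_real_derivative D) (at y) \<and> 0 \<le> D"
        using dHG nn(1) by blast
    qed
    moreover have "H s + G s \<le> H b + G b"
    proof (rule DERIV_nonneg_imp_nondecreasing[OF s(2)])
      fix y assume "s \<le> y"
      then have "0 < y" using ab s by linarith
      then show "\<exists>D. ((\<lambda>s. H s + G s) has_real_derivative D) (at y) \<and> 0 \<le> D"
        using dHG' nn(2) by blast
    qed
    moreover have "s powr (-1/3) \<le> a powr (-1/3)"
      using ab s by (intro powr_mono2') auto
    then have "M * s powr (-1/3) \<le> M * a powr (-1/3)"
      using M_nonneg by (rule mult_left_mono)
    ultimately show ?thesis
      by (simp add: H_def algebra_simps abs_le_iff)
  qed
  have cG: "continuous_on {a..b} G"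
    unfolding G_def using ab by (intro continuous_on_powr_mult continuous_F)
  have "((\<lambda>s. G b - G s) has_integral (b - a) * G b - integral {a..b} G) {a..b}"
    using ab cG has_integral_const_real[of "G b" a b]
    by (intro has_integral_diff integrable_integral integrable_continuous_interval) auto
  then have "norm ((b - a) * G b - integral {a..b} G)
      \<le> (12 * M * (a powr (-1/3) - b powr (-1/3))) * measure lborel {a..b}"
    using diff order_trans[OF abs_ge_zero diff[of b]] ab
    by (intro has_integral_bound_real[where S = "{}" and f = "\<lambda>s. G b - G s"]) auto
  moreover have "measure lborel {a..b} = b - a"
    using ab by simp
  ultimately show ?thesis
    by (simp only: G_def real_norm_def mult_ac)
qed

end

subsection \<open>The two quadrature sums\<close>

lemma powr_thirds_mult_self:
  fixes h :: real
  assumes "0 < h"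
  shows "h powr (-1/3) * h = h powr (2/3)" "h powr (-4/3) * h = h powr (-1/3)"
    "h powr (-4/3) * h\<^sup>2 = h powr (2/3)" "h powr (-7/3) * h = h powr (-4/3)"
  using assms powr_add[of h "-1/3" 1] powr_add[of h "-4/3" 1] powr_add[of h "-4/3" 2]
    powr_add[of h "-7/3" 1]
  by simp_all

text \<open>Intended for \<open>p\<close> and \<open>y\<close> powers of one number, whose exponents
  \<open>powr_thirds_mult_self\<close> merges into \<open>q\<close>.\<close>

lemma abs_mult_le_factor:
  fixes p x c y q :: real
  assumes "0 \<le> p" "\<bar>x\<bar> \<le> c * y" "p * y = q"
  shows "\<bar>p * x\<bar> \<le> c * q"
proof -
  have "\<bar>p * x\<bar> \<le> p * (c * y)"
    using assms by (simp add: abs_mult mult_left_mono)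
  also have "\<dots> = c * q"
    using assms(3) by (simp add: mult.left_commute)
  finally show ?thesis .
qed

text \<open>Integral comparison: the first term is 1 and the others are at most the integral over
  \<open>{1..}\<close>, which is 3. The induction carries the sharper bound
  \<open>4 - 3 * real K powr (-1/3)\<close>, which absorbs each new term.\<close>

lemma sum_powr_minus_4_3_le:
  "(\<Sum>l=1..K. real l powr (-4/3)) \<le> 4"
proof (cases "K = 0")
  case False
  then have "1 \<le> K" by simp
  then have "(\<Sum>l=1..K. real l powr (-4/3)) \<le> 4 - 3 * real K powr (-1/3)"
  proof (induction K rule: nat_induct_at_least)
    case (Suc k)
    have i: "((\<lambda>s::real. s powr (-4/3)) has_integral
        3 * (real k powr (-1/3) - real (Suc k) powr (-1/3))) {real k..real (Suc k)}"
      using Suc by (intro has_integral_powr_minus_4_3) auto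
    have "real (Suc k) powr (-4/3) \<le> s powr (-4/3)" if "s \<in> {real k..real (Suc k)}" for s
      using that Suc by (intro powr_mono2') auto
    then have "real (Suc k) powr (-4/3) * 1 \<le> 3 * (real k powr (-1/3) - real (Suc k) powr (-1/3))"
      using has_integral_le[OF has_integral_const_real[of "real (Suc k) powr (-4/3)" "real k" "real (Suc k)"] i]
      by simp
    then show ?case
      using Suc.IH by simp
  qed simp
  then show ?thesis
    by (rule order_trans) simp
qed simp

context flat_at_origin
begin

text \<open>Successive slopes differ by a second difference of the profile divided by
  \<open>h\<close>: the linear part of \<open>F\<close> adds the same constant to every slope and
  cancels.\<close>

definition slope :: "real \<Rightarrow> nat \<Rightarrow> real" where
  "slope h l = (F (real (Suc l) * h) - F (real l * h)) / h"

lemma slope_le: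
  assumes "0 < h"
  shows "\<bar>slope h l\<bar> \<le> M"
  using F_lipschitz[of "real l * h" "real (Suc l) * h"] assms
  by (simp add: slope_def abs_div field_simps)

text \<open>Abel summation moves the difference from the slopes to the weights, leaving boundary
  terms at \<open>l = K\<close> and \<open>l = 0\<close>. Each interior term is one cell of
  \<open>increment_cell_error\<close>, and the cell errors telescope. For \<open>K = 1\<close> there
  is no cell and both sides vanish.\<close>

lemma summation_by_parts_error:
  assumes h: "0 < h" and K: "1 \<le> K"
  shows "\<bar>(\<Sum>l=1..K. (real l * h) powr (-1/3) * (slope h l - slope h (l - 1)))
      - (real K * h) powr (-1/3) * slope h K + h powr (-1/3) * slope h 0
      - 1/3 * integral {h..real K * h} (\<lambda>s. s powr (-4/3) * F1 s)\<bar>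
    \<le> M * h * (h powr (-1/3) - (real K * h) powr (-1/3))"
  using K
proof (induction K rule: nat_induct_at_least)
  case (Suc k)
  define a where "a = real k * h"
  define b where "b = real (Suc k) * h"
  have ab: "0 < a" "a < b" "b - a = h" "h \<le> a"
    using h Suc by (auto simp: a_def b_def algebra_simps)
  have "integral {h..a} (\<lambda>s. s powr (-4/3) * F1 s) + integral {a..b} (\<lambda>s. s powr (-4/3) * F1 s)
      = integral {h..b} (\<lambda>s. s powr (-4/3) * F1 s)"
    using ab h
    by (intro Henstock_Kurzweil_Integration.integral_combine integrable_continuous_interval
        continuous_on_powr_mult continuous_F1) auto
  \<comment> \<open>This product is the net change of the sum minus its boundary term at the far
    end: the contributions of \<open>slope h (Suc k)\<close> cancel.\<close>
  moreover have "\<bar>(a powr (-1/3) - b powr (-1/3)) * slope h k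
      - 1/3 * integral {a..b} (\<lambda>s. s powr (-4/3) * F1 s)\<bar>
    \<le> M * h * (a powr (-1/3) - b powr (-1/3))"
    using increment_cell_error[OF ab(1,2)] unfolding ab(3) by (simp add: slope_def a_def b_def)
  moreover have "(\<Sum>l=1..Suc k. (real l * h) powr (-1/3) * (slope h l - slope h (l - 1)))
    = (\<Sum>l=1..k. (real l * h) powr (-1/3) * (slope h l - slope h (l - 1)))
      + b powr (-1/3) * (slope h (Suc k) - slope h k)"
    by (simp add: b_def)
  moreover note Suc.IH[folded a_def]
  ultimately show ?case
    unfolding b_def[symmetric] right_diff_distrib left_diff_distrib by linarith
qed (simp add: right_diff_distrib)

text \<open>Discrete and continuous boundary terms are estimated separately: those at
  \<open>h\<close> are of order \<open>h powr (2/3)\<close> since \<open>slope h 0\<close> and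
  \<open>F1 h\<close> are at most \<open>M * h\<close>, those at \<open>A\<close> of order
  \<open>A powr (-1/3)\<close>. Their coefficients add up to 9/2 and 4, hence 5.\<close>

lemma second_difference_sum_error:
  assumes h: "0 < h" and K: "1 \<le> K"
  shows "\<bar>(\<Sum>l=1..K. (real l * h) powr (-1/3) * (slope h l - slope h (l - 1)))
      - integral {0..} (\<lambda>s. s powr (-1/3) * F2 s)\<bar>
    \<le> 5 * M * (h powr (2/3) + (real K * h) powr (-1/3))"
proof -
  define A where "A = real K * h"
  have A: "h \<le> A" "0 < A"
    using h K by (auto simp: A_def)
  have F1h: "\<bar>h powr (-1/3) * F1 h\<bar> \<le> M * h powr (2/3)"
    using F1_le_linear[of h] h
    by (intro abs_mult_le_factor[where y = h] powr_thirds_mult_self) simp_all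
  have "\<bar>F h\<bar> \<le> M * h * h"
    using F_le_quadratic[of h] h by (simp add: power2_eq_square mult_ac)
  then have "\<bar>slope h 0\<bar> \<le> M * h"
    using h F_0 by (simp add: slope_def abs_div divide_le_eq)
  then have s0: "\<bar>h powr (-1/3) * slope h 0\<bar> \<le> M * h powr (2/3)"
    using h by (intro abs_mult_le_factor[where y = h] powr_thirds_mult_self) simp_all
  have sK: "\<bar>A powr (-1/3) * slope h K\<bar> \<le> M * A powr (-1/3)"
    using slope_le[OF h, of K] by (simp add: abs_mult mult.commute mult_right_mono)
  have F1A: "\<bar>A powr (-1/3) * F1 A\<bar> \<le> M * A powr (-1/3)"
    using F1_le[of A] A by (simp add: abs_mult mult.commute mult_right_mono)
  have "M * h * (h powr (-1/3) - A powr (-1/3)) \<le> M * h powr (2/3)"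
    using h M_nonneg powr_thirds_mult_self(1)[OF h] by (simp add: right_diff_distrib mult_ac)
  moreover have "0 \<le> M * h powr (2/3)" "0 \<le> M * A powr (-1/3)"
    using M_nonneg by auto
  ultimately show ?thesis
    using summation_by_parts_error[OF h K] half_line_integral_approx[OF h A(1)]
      kernel_integral_eq1[OF h A(1)] F1h s0 sK F1A
    unfolding A_def[symmetric] distrib_left by linarith
qed

text \<open>The rule uses right endpoints, so the node \<open>h\<close> belongs to the cell
  \<open>{0..h}\<close> outside the integral; its term is subtracted here and estimated
  later.\<close>

lemma rectangle_sum_error:
  assumes h: "0 < h" and K: "1 \<le> K"
  shows "\<bar>(\<Sum>l=1..K. h * ((real l * h) powr (-7/3) * F (real l * h)))
      - h * (h powr (-7/3) * F h) - integral {h..real K * h} (\<lambda>s. s powr (-7/3) * F s)\<bar>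
    \<le> 12 * M * h * (h powr (-1/3) - (real K * h) powr (-1/3))"
  using K
proof (induction K rule: nat_induct_at_least)
  case (Suc k)
  define a where "a = real k * h"
  define b where "b = real (Suc k) * h"
  have ab: "0 < a" "a < b" "b - a = h" "h \<le> a"
    using h Suc by (auto simp: a_def b_def algebra_simps)
  have "integral {h..a} (\<lambda>s. s powr (-7/3) * F s) + integral {a..b} (\<lambda>s. s powr (-7/3) * F s)
      = integral {h..b} (\<lambda>s. s powr (-7/3) * F s)"
    using ab h
    by (intro Henstock_Kurzweil_Integration.integral_combine integrable_continuous_interval
        continuous_on_powr_mult continuous_F) auto
  moreover have "\<bar>h * (b powr (-7/3) * F b) - integral {a..b} (\<lambda>s. s powr (-7/3) * F s)\<bar>
    \<le> 12 * M * h * (a powr (-1/3) - b powr (-1/3))"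
    using rectangle_cell_error[OF ab(1,2)] unfolding ab(3) .
  moreover have "(\<Sum>l=1..Suc k. h * ((real l * h) powr (-7/3) * F (real l * h)))
    = (\<Sum>l=1..k. h * ((real l * h) powr (-7/3) * F (real l * h))) + h * (b powr (-7/3) * F b)"
    by (simp add: b_def)
  moreover note Suc.IH[folded a_def]
  ultimately show ?case
    unfolding b_def[symmetric] right_diff_distrib by linarith
qed simp

text \<open>The node at \<open>h\<close> contributes order \<open>h powr (2/3)\<close> by the
  quadratic bound, and \<open>kernel_integral_eq2\<close> converts the integral into the kernel
  integral up to boundary terms. The coefficients 4/9 * 13 + 4/3 + 3/2 and 4/3 + 2 are both below
  9.\<close>

lemma quadrature_sum_error:
  assumes h: "0 < h" and K: "1 \<le> K"
  shows "\<bar>4/9 * (\<Sum>l=1..K. h * ((real l * h) powr (-7/3) * F (real l * h)))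
      - integral {0..} (\<lambda>s. s powr (-1/3) * F2 s)\<bar>
    \<le> 9 * M * (h powr (2/3) + (real K * h) powr (-1/3))"
proof -
  define A where "A = real K * h"
  have A: "h \<le> A" "0 < A"
    using h K by (auto simp: A_def)
  have F1h: "\<bar>h powr (-1/3) * F1 h\<bar> \<le> M * h powr (2/3)"
    using F1_le_linear[of h] h
    by (intro abs_mult_le_factor[where y = h] powr_thirds_mult_self) simp_all
  have Fh: "\<bar>h powr (-4/3) * F h\<bar> \<le> M * h powr (2/3)"
    using F_le_quadratic[of h] h
    by (intro abs_mult_le_factor[where y = "h\<^sup>2"] powr_thirds_mult_self) simp_all
  have hF: "h * (h powr (-7/3) * F h) = h powr (-4/3) * F h"
    using powr_thirds_mult_self(4)[OF h] by (metis mult.assoc mult.commute)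
  have F1A: "\<bar>A powr (-1/3) * F1 A\<bar> \<le> M * A powr (-1/3)"
    using F1_le[of A] A by (simp add: abs_mult mult.commute mult_right_mono)
  have FA: "\<bar>A powr (-4/3) * F A\<bar> \<le> M * A powr (-1/3)"
    using F_le_linear[of A] A
    by (intro abs_mult_le_factor[where y = A] powr_thirds_mult_self) simp_all
  have "12 * M * h * (h powr (-1/3) - A powr (-1/3)) \<le> 12 * (M * h powr (2/3))"
  proof -
    have "12 * M * h * (h powr (-1/3) - A powr (-1/3)) =
        12 * (M * (h powr (-1/3) * h)) - 12 * M * h * A powr (-1/3)"
      by (simp add: algebra_simps)
    then show ?thesis
      using h M_nonneg by (simp only: powr_thirds_mult_self[OF h]) simp
  qed
  moreover have "0 \<le> M * h powr (2/3)" "0 \<le> M * A powr (-1/3)"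
    using M_nonneg by auto
  moreover have "\<bar>kernel_integral h A - 4/9 * integral {h..A} (\<lambda>s. s powr (-7/3) * F s)\<bar>
      \<le> 4/3 * (M * h powr (2/3)) + 4/3 * (M * A powr (-1/3))"
  proof -
    have "\<bar>(a - b + 1/3 * (c - d) + 4/9 * i) - 4/9 * i\<bar> \<le> 4/3 * p + 4/3 * q"
      if "\<bar>a\<bar> \<le> q" "\<bar>b\<bar> \<le> p" "\<bar>c\<bar> \<le> q" "\<bar>d\<bar> \<le> p" for a b c d i p q :: real
      using that unfolding abs_le_iff by argo
    from this[OF F1A F1h FA Fh] show ?thesis
      unfolding kernel_integral_eq2[OF h A(1)] .
  qed
  moreover have "\<bar>(\<Sum>l=1..K. h * ((real l * h) powr (-7/3) * F (real l * h)))
      - integral {h..A} (\<lambda>s. s powr (-7/3) * F s)\<bar> \<le> 13 * (M * h powr (2/3))"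
    using rectangle_sum_error[OF h K] Fh calculation(1) unfolding A_def[symmetric] hF by linarith
  ultimately show ?thesis
    using half_line_integral_approx[OF h A(1)] unfolding A_def[symmetric] distrib_left by linarith
qed

end

subsection \<open>Consistency of the discrete nonlocal operators\<close>

lemma taylor_second_order:
  fixes f f1 f2 :: "real \<Rightarrow> real"
  assumes df: "\<And>s. (f has_real_derivative f1 s) (at s)"
    and df1: "\<And>s. (f1 has_real_derivative f2 s) (at s)"
    and "x \<noteq> y"
  obtains t where "min x y < t" "t < max x y"
    "f y = f x + f1 x * (y - x) + f2 t / 2 * (y - x)\<^sup>2"
proof -
  \<comment> \<open>\<open>Taylor\<close> takes a sequence of derivatives; only indices 0, 1, 2
    enter at this order, so the value for larger \<open>k\<close> is a filler.\<close>
  define d where "d k = (if k = 0 then f else if k = 1 then f1 else f2)" for k :: nat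
  have "\<exists>t. (if y < x then y < t \<and> t < x else x < t \<and> t < y) \<and>
      f y = (\<Sum>m<2. d m x / fact m * (y - x) ^ m) + d 2 t / fact 2 * (y - x) ^ 2"
    by (rule Taylor[where a = "min x y" and b = "max x y"])
      (use \<open>x \<noteq> y\<close> df df1 in \<open>auto simp: d_def less_2_cases_iff\<close>)
  then obtain t where t: "if y < x then y < t \<and> t < x else x < t \<and> t < y"
    "f y = (\<Sum>m<2. d m x / fact m * (y - x) ^ m) + d 2 t / fact 2 * (y - x) ^ 2"
    by blast
  show thesis
    by (rule that[of t]) (use t in \<open>auto simp: d_def numeral_2_eq_2 split: if_splits\<close>)
qed

lemma first_order_remainder_le:
  fixes f f1 f2 :: "real \<Rightarrow> real"
  assumes "\<And>s. (f has_real_derivative f1 s) (at s)" "\<And>s. (f1 has_real_derivative f2 s) (at s)"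
    and b: "\<And>s. min x y \<le> s \<Longrightarrow> s \<le> max x y \<Longrightarrow> \<bar>f2 s\<bar> \<le> M"
  shows "\<bar>f y - f x - f1 x * (y - x)\<bar> \<le> M * (y - x)\<^sup>2"
proof (cases "x = y")
  case False
  obtain t where t: "min x y < t" "t < max x y" "f y = f x + f1 x * (y - x) + f2 t / 2 * (y - x)\<^sup>2"
    using taylor_second_order[OF assms(1,2) False] by blast
  then have "\<bar>f2 t / 2\<bar> \<le> M"
    using b[of t] by simp
  then have "\<bar>f2 t / 2\<bar> * (y - x)\<^sup>2 \<le> M * (y - x)\<^sup>2"
    by (rule mult_right_mono) simp
  then show ?thesis
    using t(3) by (simp add: abs_mult)
qed simp

text \<open>A time slice of the solution. The bounds hold on a left half-line because the operator
  looks left; \<open>X\<close> must leave room for the right neighbour in the central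
  difference.\<close>

locale bounded_profile =
  fixes f f1 f2 :: "real \<Rightarrow> real" and M X :: real
  assumes df: "(f has_real_derivative f1 s) (at s)"
    and df1: "(f1 has_real_derivative f2 s) (at s)"
    and cf2: "continuous_on UNIV f2"
    and f1_le: "s \<le> X \<Longrightarrow> \<bar>f1 s\<bar> \<le> M"
    and f2_le: "s \<le> X \<Longrightarrow> \<bar>f2 s\<bar> \<le> M"
begin

lemma M_nonneg: "0 \<le> M"
  using f1_le[of X] by simp

text \<open>The factor 2 comes from \<open>f1 x - f1 (x - s)\<close>, a difference of two values
  bounded by \<open>M\<close>.\<close>

lemma flat_at_origin_remainder:
  assumes "x \<le> X"
  shows "flat_at_origin (\<lambda>s. f (x - s) - f x + f1 x * s) (\<lambda>s. f1 x - f1 (x - s)) (\<lambda>s. f2 (x - s)) (2 * M)"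
proof
  fix s :: real
  have df': "((\<lambda>s. g (x - s)) has_real_derivative - g' (x - s)) (at s)"
    if "\<And>s. (g has_real_derivative g' s) (at s)" for g g' :: "real \<Rightarrow> real"
  proof -
    have "((\<lambda>s. x - s) has_real_derivative - 1) (at s)"
      by (auto intro!: derivative_eq_intros)
    from DERIV_chain2[OF that this] show ?thesis by simp
  qed
  show "((\<lambda>s. f (x - s) - f x + f1 x * s) has_real_derivative f1 x - f1 (x - s)) (at s)"
    by (auto intro!: derivative_eq_intros df'[OF df])
  show "((\<lambda>s. f1 x - f1 (x - s)) has_real_derivative f2 (x - s)) (at s)"
    by (auto intro!: derivative_eq_intros df'[OF df1])
  show "continuous_on UNIV (\<lambda>s. f2 (x - s))"
    by (intro continuous_on_compose2[OF cf2] continuous_intros) auto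
  show "\<bar>f1 x - f1 (x - s)\<bar> \<le> 2 * M" if "0 \<le> s"
    using f1_le[of x] f1_le[of "x - s"] assms that by linarith
  show "\<bar>f2 (x - s)\<bar> \<le> 2 * M" if "0 \<le> s"
    using f2_le[of "x - s"] assms that M_nonneg by linarith
qed auto

lemma nonlocal_eq: "nonlocal f x = integral {0..} (\<lambda>s. s powr (-1/3) * f2 (x - s))"
proof -
  have "deriv f = f1" "deriv f1 = f2"
    using DERIV_imp_deriv[OF df] DERIV_imp_deriv[OF df1] by auto
  then show ?thesis
    unfolding nonlocal_def by (intro integral_cong) simp
qed

text \<open>After rescaling, \<open>h powr (-4/3) * h\<close> turns the weights into
  \<open>(real l * h) powr (-1/3)\<close> and the second differences into slope increments. The
  constant 25 exceeds the 5 * 2 obtained, so as to be shared with the second operator.\<close>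

lemma nonlocal1_error:
  fixes m :: int
  assumes h: "0 < h" and K: "1 \<le> K" and x: "of_int m * h \<le> X"
  shows "\<bar>nonlocal f (of_int m * h) - nonlocal1 K h (\<lambda>j. f (of_int j * h)) m\<bar>
    \<le> 25 * M * (h powr (2/3) + (real K * h) powr (-1/3))"
proof -
  define y where "y = of_int m * h"
  interpret R: flat_at_origin "\<lambda>s. f (y - s) - f y + f1 y * s" "\<lambda>s. f1 y - f1 (y - s)"
    "\<lambda>s. f2 (y - s)" "2 * M"
    using x by (intro flat_at_origin_remainder) (simp add: y_def)
  define q where "q = R.slope h"
  have q: "h * q l = f (y - real (Suc l) * h) - f (y - real l * h) + f1 y * h" for l
  proof -
    have "h * q l = f (y - real (Suc l) * h) - f y + f1 y * (real (Suc l) * h)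
        - (f (y - real l * h) - f y + f1 y * (real l * h))"
      unfolding q_def R.slope_def using h by simp
    then show ?thesis by (simp add: algebra_simps)
  qed
  have "h powr (-4/3) * (real l powr (-1/3) * (f (of_int (m - int l + 1) * h)
        - 2 * f (of_int (m - int l) * h) + f (of_int (m - int l - 1) * h)))
      = (real l * h) powr (-1/3) * (q l - q (l - 1))" if l: "l \<in> {1..K}" for l
  proof -
    have p: "h powr (-4/3) * h = h powr (-1/3)"
      using powr_thirds_mult_self(2)[OF h] .
    have e: "of_int (m - int l + 1) * h = y - real (l - 1) * h" "of_int (m - int l) * h = y - real l * h"
      "of_int (m - int l - 1) * h = y - real (Suc l) * h"
      using l by (auto simp: y_def algebra_simps of_nat_diff)
    have "h * (q l - q (l - 1)) = f (y - real (l - 1) * h) - 2 * f (y - real l * h)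
        + f (y - real (Suc l) * h)"
      unfolding right_diff_distrib q using l by (simp add: of_nat_diff)
    then have "h powr (-4/3) * (real l powr (-1/3) * (f (of_int (m - int l + 1) * h)
        - 2 * f (of_int (m - int l) * h) + f (of_int (m - int l - 1) * h)))
      = (h powr (-4/3) * h) * real l powr (-1/3) * (q l - q (l - 1))"
      unfolding e by (simp add: mult_ac)
    then show ?thesis
      unfolding p using h by (simp add: powr_mult mult_ac)
  qed
  then have "nonlocal1 K h (\<lambda>j. f (of_int j * h)) m =
      (\<Sum>l=1..K. (real l * h) powr (-1/3) * (q l - q (l - 1)))"
    unfolding nonlocal1_def sum_distrib_left by (intro sum.cong) auto
  moreover have "5 * (2 * M) * (h powr (2/3) + (real K * h) powr (-1/3))
      \<le> 25 * M * (h powr (2/3) + (real K * h) powr (-1/3))"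
    using M_nonneg by (intro mult_right_mono) auto
  ultimately show ?thesis
    using R.second_difference_sum_error[OF h K] unfolding nonlocal_eq y_def[symmetric] q_def[symmetric] by linarith
qed

text \<open>The operator is the rectangle sum for \<open>F\<close> plus the effect of replacing
  \<open>f1 y * h\<close> by a central difference. That defect is of order \<open>h\<^sup>2\<close>
  and is summed against \<open>real l powr (-4/3)\<close>, so it stays of order
  \<open>h powr (2/3)\<close> uniformly in \<open>K\<close>. The coefficients are 9 * 2 + 4/9 * 4
  and 18, both below 25.\<close>

lemma nonlocal2_error:
  fixes m :: int
  assumes h: "0 < h" and K: "1 \<le> K" and x: "of_int (m + 1) * h \<le> X"
  shows "\<bar>nonlocal f (of_int m * h) - nonlocal2 K h (\<lambda>j. f (of_int j * h)) m\<bar>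
    \<le> 25 * M * (h powr (2/3) + (real K * h) powr (-1/3))"
proof -
  define y where "y = of_int m * h"
  have y: "y + h \<le> X" "of_int (m + 1) * h = y + h" "of_int (m - 1) * h = y - h"
    using x by (auto simp: y_def algebra_simps)
  interpret R: flat_at_origin "\<lambda>s. f (y - s) - f y + f1 y * s" "\<lambda>s. f1 y - f1 (y - s)"
    "\<lambda>s. f2 (y - s)" "2 * M"
    using y h by (intro flat_at_origin_remainder) simp
  \<comment> \<open>Half the difference of the two first-order remainders at \<open>y + h\<close>
    and \<open>y - h\<close>.\<close>
  define c where "c = (f (y + h) - f (y - h)) / 2 - f1 y * h"
  have "\<bar>f (y + h) - f y - f1 y * (y + h - y)\<bar> \<le> M * (y + h - y)\<^sup>2"
    "\<bar>f (y - h) - f y - f1 y * (y - h - y)\<bar> \<le> M * (y - h - y)\<^sup>2"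
    using h y by (intro first_order_remainder_le[OF df df1] f2_le; simp)+
  then have c: "\<bar>c\<bar> \<le> M * h\<^sup>2"
    unfolding c_def by (simp add: abs_le_iff field_simps)
  have "h powr (-4/3) * (real l powr (-7/3) * (f (of_int (m - int l) * h) - f y
        + real l * ((f (y + h) - f (y - h)) / 2)))
      = h * ((real l * h) powr (-7/3) * (f (y - real l * h) - f y + f1 y * (real l * h)))
        + h powr (-4/3) * c * real l powr (-4/3)" if l: "l \<in> {1..K}" for l
  proof -
    have p: "h powr (-7/3) * h = h powr (-4/3)" "real l powr (-7/3) * real l = real l powr (-4/3)"
      using powr_thirds_mult_self(4)[OF h] powr_thirds_mult_self(4)[of "real l"] l by auto
    have e: "of_int (m - int l) * h = y - real l * h"
      by (simp add: y_def algebra_simps)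
    define q where "q = real l powr (-7/3)"
    have "h powr (-4/3) * (q * (f (of_int (m - int l) * h) - f y
        + real l * ((f (y + h) - f (y - h)) / 2)))
      = h powr (-4/3) * q * (f (y - real l * h) - f y + f1 y * (real l * h))
        + h powr (-4/3) * c * (q * real l)"
      unfolding e c_def by (simp add: algebra_simps)
    moreover have "h * ((real l * h) powr (-7/3) * Z) = (h powr (-7/3) * h) * q * Z" for Z
      unfolding q_def using h by (simp add: powr_mult mult_ac)
    from this[of "f (y - real l * h) - f y + f1 y * (real l * h)"] calculation
    show ?thesis
      unfolding q_def p by linarith
  qed
  then have "nonlocal2 K h (\<lambda>j. f (of_int j * h)) m =
      4/9 * (\<Sum>l=1..K. h * ((real l * h) powr (-7/3) * (f (y - real l * h) - f y + f1 y * (real l * h))))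
      + 4/9 * (h powr (-4/3) * c * (\<Sum>l=1..K. real l powr (-4/3)))"
    unfolding nonlocal2_def y(2,3) y_def[symmetric] mult.assoc[of "4/9"] distrib_left[symmetric]
      sum_distrib_left[of "h powr (-4/3)"] sum_distrib_left[of "h powr (-4/3) * c"] sum.distrib[symmetric]
    by simp
  moreover have "\<bar>h powr (-4/3) * c * (\<Sum>l=1..K. real l powr (-4/3))\<bar> \<le> M * h powr (2/3) * 4"
  proof -
    have "\<bar>h powr (-4/3) * c\<bar> \<le> M * h powr (2/3)"
      using c h by (intro abs_mult_le_factor[where y = "h\<^sup>2"] powr_thirds_mult_self) simp_all
    moreover have "\<bar>\<Sum>l=1..K. real l powr (-4/3)\<bar> \<le> 4"
      using sum_powr_minus_4_3_le[of K] by (simp add: sum_nonneg)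
    ultimately show ?thesis
      unfolding abs_mult[of "h powr (-4/3) * c"] using M_nonneg by (intro mult_mono) auto
  qed
  moreover have "0 \<le> M * h powr (2/3)" "0 \<le> M * (real K * h) powr (-1/3)"
    using M_nonneg by auto
  ultimately show ?thesis
    using R.quadrature_sum_error[OF h K] unfolding nonlocal_eq y_def[symmetric] distrib_left
    by linarith
qed

end

subsection \<open>The local terms\<close>

lemma smooth_pd_x: "smooth \<phi> \<Longrightarrow> smooth (pd_x \<phi>)"
  and smooth_pd_t: "smooth \<phi> \<Longrightarrow> smooth (pd_t \<phi>)"
  unfolding smooth_def by (metis C_k.simps(2))+

lemma smooth_continuous: "smooth \<phi> \<Longrightarrow> continuous_on S (\<lambda>(t, x). \<phi> t x)"
  unfolding smooth_def by (metis C_k.simps(1) continuous_on_subset top_greatest)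

lemma smooth_continuous_x:
  assumes "smooth \<phi>"
  shows "continuous_on S (\<phi> t)"
  using continuous_on_compose2[OF smooth_continuous[OF assms, of UNIV], of S "\<lambda>x. (t, x)"]
  by (simp add: continuous_on_Pair)

lemma smooth_has_pd_x:
  assumes "smooth \<phi>"
  shows "(\<phi> t has_real_derivative pd_x \<phi> t x) (at x)"
proof -
  have "C_k (Suc 0) \<phi>"
    using assms unfolding smooth_def by blast
  then have "\<phi> t differentiable (at x)"
    by simp
  then show ?thesis
    unfolding pd_x_def by (simp add: DERIV_deriv_iff_real_differentiable)
qed

lemma smooth_has_pd_t:
  assumes "smooth \<phi>"
  shows "((\<lambda>s. \<phi> s x) has_real_derivative pd_t \<phi> t x) (at t)"
proof -
  have "C_k (Suc 0) \<phi>"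
    using assms unfolding smooth_def by blast
  then have "(\<lambda>s. \<phi> s x) differentiable (at t)"
    by simp
  then show ?thesis
    unfolding pd_t_def by (simp add: DERIV_deriv_iff_real_differentiable)
qed

lemma smooth_bounded_on_rectangle:
  assumes "smooth \<phi>"
  obtains B where "\<And>t x. t \<in> {a..b} \<Longrightarrow> x \<in> {c..d} \<Longrightarrow> \<bar>\<phi> t x\<bar> \<le> B"
proof -
  have "bounded ((\<lambda>(t, x). \<phi> t x) ` ({a..b} \<times> {c..d}))"
    by (intro compact_imp_bounded compact_continuous_image smooth_continuous[OF assms]
        compact_Times compact_Icc)
  then obtain B where "\<forall>y \<in> (\<lambda>(t, x). \<phi> t x) ` ({a..b} \<times> {c..d}). norm y \<le> B"
    unfolding bounded_iff by blast
  then have "\<bar>\<phi> t x\<bar> \<le> B" if "t \<in> {a..b}" "x \<in> {c..d}" for t x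
    using that by force
  then show thesis by (rule that)
qed

text \<open>The hypothesis gives bounds only up to \<open>D\<close>; beyond it, up to
  \<open>D'\<close>, continuity on a compact rectangle does.\<close>

lemma smooth_pd_x_bounded:
  assumes "smooth \<phi>" "bounded_x_derivs T D \<phi>" "k \<in> {1..4}"
  obtains B where "\<And>t x. t \<in> {0..T} \<Longrightarrow> x \<le> D' \<Longrightarrow> \<bar>(pd_x ^^ k) \<phi> t x\<bar> \<le> B"
proof -
  have "smooth ((pd_x ^^ k) \<phi>)" for k
    by (induction k) (simp_all add: assms smooth_pd_x)
  then obtain B1 where B1: "\<And>t x. t \<in> {0..T} \<Longrightarrow> x \<in> {D..D'} \<Longrightarrow> \<bar>(pd_x ^^ k) \<phi> t x\<bar> \<le> B1"
    using smooth_bounded_on_rectangle by blast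
  have "bounded ((\<lambda>(t, x). (pd_x ^^ k) \<phi> t x) ` ({0..T} \<times> {..D}))"
    using assms unfolding bounded_x_derivs_def by blast
  then obtain B2 where "\<forall>y \<in> (\<lambda>(t, x). (pd_x ^^ k) \<phi> t x) ` ({0..T} \<times> {..D}). norm y \<le> B2"
    unfolding bounded_iff by blast
  then have B2: "\<bar>(pd_x ^^ k) \<phi> t x\<bar> \<le> B2" if "t \<in> {0..T}" "x \<le> D" for t x
    using that by force
  show thesis
  proof (rule that[of "max B1 B2"])
    fix t x assume "t \<in> {0..T}" "x \<le> D'"
    then show "\<bar>(pd_x ^^ k) \<phi> t x\<bar> \<le> max B1 B2"
      using B1[of t x] B2[of t x] by (cases "x \<le> D") auto
  qed
qed

text \<open>Taylor on both sides turns the quotient into the mean of \<open>f2\<close> at two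
  intermediate points, each within \<open>h\<close> of \<open>x\<close>. First order suffices, as
  the target is only \<open>h powr (2/3)\<close>.\<close>

lemma second_difference_quotient_error:
  fixes f f1 f2 f3 :: "real \<Rightarrow> real"
  assumes df: "\<And>s. (f has_real_derivative f1 s) (at s)"
    and df1: "\<And>s. (f1 has_real_derivative f2 s) (at s)"
    and df2: "\<And>s. (f2 has_real_derivative f3 s) (at s)"
    and b: "\<And>s. s \<le> x + h \<Longrightarrow> \<bar>f3 s\<bar> \<le> M" and h: "0 < h"
  shows "\<bar>f2 x - (f (x + h) - 2 * f x + f (x - h)) / h\<^sup>2\<bar> \<le> M * h"
proof -
  have M: "0 \<le> M"
    using b[of x] h by linarith
  have lip: "\<bar>f2 s - f2 x\<bar> \<le> M * h" if s: "x - h \<le> s" "s \<le> x + h" for s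
  proof -
    have "norm (f2 s - f2 x) \<le> M * norm (s - x)"
      by (rule field_differentiable_bound[where S = "{..x + h}" and f' = f3])
        (use b df2 s h in \<open>auto intro: has_field_derivative_at_within\<close>)
    also have "\<dots> \<le> M * h"
      using s M by (intro mult_left_mono) auto
    finally show ?thesis by simp
  qed
  have "x \<noteq> x + h" "x \<noteq> x - h"
    using h by auto
  from taylor_second_order[OF df df1 this(1)] taylor_second_order[OF df df1 this(2)]
  obtain t s where "min x (x + h) < t" "t < max x (x + h)" "min x (x - h) < s" "s < max x (x - h)"
    and eqs: "f (x + h) = f x + f1 x * (x + h - x) + f2 t / 2 * (x + h - x)\<^sup>2"
      "f (x - h) = f x + f1 x * (x - h - x) + f2 s / 2 * (x - h - x)\<^sup>2"
    by metis
  then have t: "x < t" "t < x + h" and s: "x - h < s" "s < x"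
    using h by auto
  have "f (x + h) - 2 * f x + f (x - h) = ((f2 t + f2 s) / 2) * h\<^sup>2"
    unfolding eqs by (simp add: algebra_simps add_divide_distrib)
  then have eq: "(f (x + h) - 2 * f x + f (x - h)) / h\<^sup>2 = (f2 t + f2 s) / 2"
    using h by simp
  have "\<bar>f2 t - f2 x\<bar> \<le> M * h" "\<bar>f2 s - f2 x\<bar> \<le> M * h"
    using t s h by (intro lip; simp)+
  then show ?thesis
    unfolding eq abs_le_iff by argo
qed

text \<open>Negative \<open>h\<close> is allowed, so this covers both the forward difference in time
  and the backward one in space.\<close>

lemma difference_quotient_error:
  fixes f f1 f2 :: "real \<Rightarrow> real"
  assumes "\<And>s. (f has_real_derivative f1 s) (at s)" "\<And>s. (f1 has_real_derivative f2 s) (at s)"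
    and b: "\<And>s. min x (x + h) \<le> s \<Longrightarrow> s \<le> max x (x + h) \<Longrightarrow> \<bar>f2 s\<bar> \<le> M" and h: "h \<noteq> 0"
  shows "\<bar>f1 x - (f (x + h) - f x) / h\<bar> \<le> M * \<bar>h\<bar>"
proof -
  have "\<bar>f (x + h) - f x - f1 x * (x + h - x)\<bar> \<le> M * (x + h - x)\<^sup>2"
    by (rule first_order_remainder_le[OF assms(1-3)])
  then have "\<bar>f (x + h) - f x - f1 x * h\<bar> / \<bar>h\<bar> \<le> (M * \<bar>h\<bar> * \<bar>h\<bar>) / \<bar>h\<bar>"
    by (intro divide_right_mono) (simp_all add: power2_eq_square)
  moreover have "\<bar>f (x + h) - f x - f1 x * h\<bar> / \<bar>h\<bar> = \<bar>f1 x - (f (x + h) - f x) / h\<bar>"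
    using h by (simp add: abs_divide[symmetric] diff_divide_distrib abs_minus_commute)
  ultimately show ?thesis
    using h by simp
qed

text \<open>The stencils reach \<open>x + \<delta>x\<close> and \<open>t + \<delta>t\<close>, hence the doubled ranges.\<close>
locale bounded_smooth_function =
  fixes T D :: real and \<phi> :: "real \<Rightarrow> real \<Rightarrow> real" and M M\<^sub>t :: real
  assumes T: "0 < T" and D: "0 < D" and smooth: "smooth \<phi>"
    and x_bound: "k \<in> {1, 2, 3} \<Longrightarrow> t \<in> {0..T} \<Longrightarrow> x \<le> 2 * D \<Longrightarrow> \<bar>(pd_x ^^ k) \<phi> t x\<bar> \<le> M"
    and t_bound: "t \<in> {0..2 * T} \<Longrightarrow> x \<in> {0..D} \<Longrightarrow> \<bar>pd_t (pd_t \<phi>) t x\<bar> \<le> M\<^sub>t"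
begin

lemma M_nonneg: "0 \<le> M" "0 \<le> M\<^sub>t"
  using x_bound[of 1 0 0] t_bound[of 0 0] T D by auto

lemma x_bounds:
  assumes "t \<in> {0..T}" "x \<le> 2 * D"
  shows "\<bar>pd_x \<phi> t x\<bar> \<le> M" "\<bar>pd_x (pd_x \<phi>) t x\<bar> \<le> M" "\<bar>pd_x (pd_x (pd_x \<phi>)) t x\<bar> \<le> M"
  using x_bound[of 1, OF _ assms] x_bound[of 2, OF _ assms] x_bound[of 3, OF _ assms]
  by (simp_all add: numeral_2_eq_2 numeral_3_eq_3)

lemmas x_derivs = smooth_has_pd_x[OF smooth] smooth_has_pd_x[OF smooth_pd_x[OF smooth]]
  smooth_has_pd_x[OF smooth_pd_x[OF smooth_pd_x[OF smooth]]]

lemma bounded_profile_slice: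
  assumes "t \<in> {0..T}"
  shows "bounded_profile (\<phi> t) (pd_x \<phi> t) (pd_x (pd_x \<phi>) t) M (2 * D)"
  by unfold_locales (use x_bounds assms x_derivs in \<open>auto intro: smooth_continuous_x smooth_pd_x smooth\<close>)

text \<open>Only the consistency bound for \<open>I\<close> enters, so both operators are handled at
  once. The error splits into four differences, one for each term of the equation.\<close>

lemma local_error_bound:
  assumes pos: "0 \<le> v" "0 \<le> \<epsilon>" "0 \<le> \<eta>"
    and N: "N\<^sub>t \<ge> 1" "N\<^sub>x \<ge> 1" "n \<le> N\<^sub>t" "0 \<le> m" "m \<le> int N\<^sub>x"
    and dt: "\<delta>t = T / real N\<^sub>t" and dx: "\<delta>x = D / real N\<^sub>x"
    and I: "\<bar>nonlocal (\<phi> (real n * \<delta>t)) (of_int m * \<delta>x) - I \<delta>x (grid_fun \<delta>t \<delta>x \<phi> n) m\<bar>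
      \<le> 25 * M * (\<delta>x powr (2/3) + A powr (-1/3))"
  shows "\<bar>local_error I v \<epsilon> \<eta> \<delta>t \<delta>x \<phi> n m\<bar>
    \<le> (M\<^sub>t + (v + \<epsilon>) * M * D powr (1/3) + 25 * \<eta> * M) * (\<delta>t + \<delta>x powr (2/3) + A powr (-1/3))"
proof -
  define t x where "t = real n * \<delta>t" and "x = of_int m * \<delta>x"
  have pt: "0 < \<delta>t" "\<delta>t \<le> T" "0 < \<delta>x" "\<delta>x \<le> D"
    using N T D by (auto simp: dt dx field_simps)
  have t: "0 \<le> t" "t \<le> T"
    using N T unfolding t_def dt by (auto simp: field_simps)
  have x: "0 \<le> x" "x \<le> D"
    using N D unfolding x_def dx by (auto simp: field_simps)
  have g: "grid_fun \<delta>t \<delta>x \<phi> (n + 1) m = \<phi> (t + \<delta>t) x" "grid_fun \<delta>t \<delta>x \<phi> n m = \<phi> t x"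
    "grid_fun \<delta>t \<delta>x \<phi> n (m + 1) = \<phi> t (x + \<delta>x)" "grid_fun \<delta>t \<delta>x \<phi> n (m - 1) = \<phi> t (x - \<delta>x)"
    by (auto simp: grid_fun_def t_def x_def algebra_simps)
  have e_t: "\<bar>pd_t \<phi> t x - (\<phi> (t + \<delta>t) x - \<phi> t x) / \<delta>t\<bar> \<le> M\<^sub>t * \<delta>t"
    using difference_quotient_error[OF smooth_has_pd_t[OF smooth] smooth_has_pd_t[OF smooth_pd_t[OF smooth]],
        where x = t and h = \<delta>t and M = M\<^sub>t] t_bound t x pt by auto
  have "\<bar>pd_x \<phi> t x - (\<phi> t (x + (- \<delta>x)) - \<phi> t x) / (- \<delta>x)\<bar> \<le> M * \<bar>- \<delta>x\<bar>"
    using x_bounds t x pt by (intro difference_quotient_error[OF x_derivs(1,2)]) auto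
  then have e_x: "\<bar>pd_x \<phi> t x - (\<phi> t x - \<phi> t (x - \<delta>x)) / \<delta>x\<bar> \<le> M * \<delta>x"
    using pt by (simp add: minus_divide_left)
  have e_xx: "\<bar>pd_x (pd_x \<phi>) t x - (\<phi> t (x + \<delta>x) - 2 * \<phi> t x + \<phi> t (x - \<delta>x)) / \<delta>x\<^sup>2\<bar> \<le> M * \<delta>x"
    using x_bounds t x pt by (intro second_difference_quotient_error[OF x_derivs]) auto
  have scale: "\<bar>c * y\<bar> \<le> c * B" if "0 \<le> c" "\<bar>y\<bar> \<le> B" for c y B :: real
    using that by (simp add: abs_mult mult_left_mono)
  have split: "local_error I v \<epsilon> \<eta> \<delta>t \<delta>x \<phi> n m =
      (pd_t \<phi> t x - (\<phi> (t + \<delta>t) x - \<phi> t x) / \<delta>t)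
      + v * (pd_x \<phi> t x - (\<phi> t x - \<phi> t (x - \<delta>x)) / \<delta>x)
      - \<epsilon> * (pd_x (pd_x \<phi>) t x - (\<phi> t (x + \<delta>x) - 2 * \<phi> t x + \<phi> t (x - \<delta>x)) / \<delta>x\<^sup>2)
      + \<eta> * (nonlocal (\<phi> t) x - I \<delta>x (grid_fun \<delta>t \<delta>x \<phi> n) m)"
    unfolding local_error_def P_op_def P_scheme_def g t_def[symmetric] x_def[symmetric]
    by (simp add: algebra_simps)
  have "\<bar>local_error I v \<epsilon> \<eta> \<delta>t \<delta>x \<phi> n m\<bar> \<le> M\<^sub>t * \<delta>t + v * (M * \<delta>x) + \<epsilon> * (M * \<delta>x)
      + \<eta> * (25 * M * (\<delta>x powr (2/3) + A powr (-1/3)))"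
    unfolding split
    using e_t scale[OF pos(1) e_x] scale[OF pos(2) e_xx] scale[OF pos(3) I] unfolding t_def[symmetric] x_def[symmetric]
    by linarith
  \<comment> \<open>Since \<open>\<delta>x \<le> D\<close>, the first-order errors of the transport
    and diffusion terms are absorbed into \<open>\<delta>x powr (2/3)\<close>.\<close>
  moreover have "\<delta>x \<le> D powr (1/3) * \<delta>x powr (2/3)"
  proof -
    have "\<delta>x = \<delta>x powr (1/3) * \<delta>x powr (2/3)"
      using pt by (simp add: powr_add[symmetric])
    also have "\<dots> \<le> D powr (1/3) * \<delta>x powr (2/3)"
      using pt by (intro mult_right_mono powr_mono2) auto
    finally show ?thesis .
  qed
  then have "M * \<delta>x \<le> M * (D powr (1/3) * \<delta>x powr (2/3))"
    using M_nonneg(1) by (rule mult_left_mono)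
  then have "v * (M * \<delta>x) \<le> v * (M * (D powr (1/3) * \<delta>x powr (2/3)))"
    "\<epsilon> * (M * \<delta>x) \<le> \<epsilon> * (M * (D powr (1/3) * \<delta>x powr (2/3)))"
    using pos by (auto intro: mult_left_mono)
  ultimately have le: "\<bar>local_error I v \<epsilon> \<eta> \<delta>t \<delta>x \<phi> n m\<bar> \<le> M\<^sub>t * \<delta>t
      + v * (M * (D powr (1/3) * \<delta>x powr (2/3))) + \<epsilon> * (M * (D powr (1/3) * \<delta>x powr (2/3)))
      + \<eta> * (25 * M * (\<delta>x powr (2/3) + A powr (-1/3)))"
    by linarith
  \<comment> \<open>The cross terms created by using one constant for all three summands are
    nonnegative.\<close>
  have "0 \<le> M\<^sub>t * (\<delta>x powr (2/3) + A powr (-1/3))"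
    "0 \<le> (v + \<epsilon>) * M * D powr (1/3) * (\<delta>t + A powr (-1/3))" "0 \<le> \<eta> * M * \<delta>t"
    using pos M_nonneg pt by auto
  with le show ?thesis
    by (simp add: algebra_simps)
qed

end

section \<open>Assembling both error bounds with a single constant\<close>

theorem proposition2:
  fixes v \<epsilon> \<eta> T D :: real and \<phi> :: "real \<Rightarrow> real \<Rightarrow> real"
  assumes "v > 0" and "\<epsilon> > 0" and "\<eta> > 0" and "T > 0" and "D > 0"
    and "smooth \<phi>" and "bounded_x_derivs T D \<phi>"
  shows "(\<exists>C\<ge>0. \<forall>(N\<^sub>t::nat) (N\<^sub>x::nat) (K::nat) (n::nat) (m::int).
            N\<^sub>t \<ge> 1 \<longrightarrow> N\<^sub>x \<ge> 1 \<longrightarrow> K \<ge> 1 \<longrightarrow> n \<le> N\<^sub>t \<longrightarrow> 0 \<le> m \<longrightarrow> m \<le> int N\<^sub>x \<longrightarrow>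
            (let \<delta>t = T / real N\<^sub>t; \<delta>x = D / real N\<^sub>x; A = real K * \<delta>x in
              \<bar>local_error (nonlocal1 K) v \<epsilon> \<eta> \<delta>t \<delta>x \<phi> n m\<bar>
              \<le> C * \<delta>t + C * \<delta>x powr (2/3) + C * A powr (-1/3)
                + C * (A powr (-1/3) * \<delta>x) + C * (A powr (2/3) * \<delta>x\<^sup>2)))
       \<and> (\<exists>C\<ge>0. \<forall>(N\<^sub>t::nat) (N\<^sub>x::nat) (K::nat) (n::nat) (m::int).
            N\<^sub>t \<ge> 1 \<longrightarrow> N\<^sub>x \<ge> 1 \<longrightarrow> K \<ge> 1 \<longrightarrow> n \<le> N\<^sub>t \<longrightarrow> 0 \<le> m \<longrightarrow> m \<le> int N\<^sub>x \<longrightarrow>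
            (let \<delta>t = T / real N\<^sub>t; \<delta>x = D / real N\<^sub>x; A = real K * \<delta>x in
              \<bar>local_error (nonlocal2 K) v \<epsilon> \<eta> \<delta>t \<delta>x \<phi> n m\<bar>
              \<le> C * \<delta>t + C * \<delta>x powr (2/3) + C * A powr (-1/3)
                + C * (A powr (-4/3) * \<delta>x) + C * (A\<^sup>2 * \<delta>x ^ 3) + C * (A * \<delta>x\<^sup>2)))"
proof -
  note pos = assms(1-3)
  have "\<exists>B. \<forall>t\<in>{0..T}. \<forall>x\<le>2 * D. \<bar>(pd_x ^^ k) \<phi> t x\<bar> \<le> B" if "k \<in> {1..4}" for k
    using smooth_pd_x_bounded[OF assms(6,7) that, of "2 * D"] by metis
  then obtain B where B: "\<And>k t x. k \<in> {1..4} \<Longrightarrow> t \<in> {0..T} \<Longrightarrow> x \<le> 2 * D \<Longrightarrow> \<bar>(pd_x ^^ k) \<phi> t x\<bar> \<le> B k"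
    by metis
  obtain M\<^sub>t where M\<^sub>t: "\<And>t x. t \<in> {0..2 * T} \<Longrightarrow> x \<in> {0..D} \<Longrightarrow> \<bar>pd_t (pd_t \<phi>) t x\<bar> \<le> M\<^sub>t"
    using smooth_bounded_on_rectangle[OF smooth_pd_t[OF smooth_pd_t[OF assms(6)]]] by metis
  define M where "M = max (B 1) (max (B 2) (B 3))"
  interpret bounded_smooth_function T D \<phi> M M\<^sub>t
  proof
    fix k :: nat and t x :: real
    assume k: "k \<in> {1, 2, 3}" and tx: "t \<in> {0..T}" "x \<le> 2 * D"
    have "\<bar>(pd_x ^^ k) \<phi> t x\<bar> \<le> B k"
      using k tx by (intro B) auto
    also have "B k \<le> M"
      using k by (auto simp: M_def)
    finally show "\<bar>(pd_x ^^ k) \<phi> t x\<bar> \<le> M" .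
  qed (use assms M\<^sub>t in auto)
  \<comment> \<open>This depends on the function and the data but not on the grid, on
    \<open>K\<close> or on the grid point, so it is a witness for both claims.\<close>
  define C where "C = M\<^sub>t + (v + \<epsilon>) * M * D powr (1/3) + 25 * \<eta> * M"
  have C: "0 \<le> C"
    unfolding C_def using pos M_nonneg by simp
  have bounds:
    "\<bar>local_error (nonlocal1 K) v \<epsilon> \<eta> \<delta>t \<delta>x \<phi> n m\<bar>
      \<le> C * \<delta>t + C * \<delta>x powr (2/3) + C * (real K * \<delta>x) powr (-1/3)" (is ?one)
    "\<bar>local_error (nonlocal2 K) v \<epsilon> \<eta> \<delta>t \<delta>x \<phi> n m\<bar>
      \<le> C * \<delta>t + C * \<delta>x powr (2/3) + C * (real K * \<delta>x) powr (-1/3)" (is ?two)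
    if N: "N\<^sub>t \<ge> 1" "N\<^sub>x \<ge> 1" "n \<le> N\<^sub>t" "0 \<le> m" "m \<le> int N\<^sub>x" and K: "K \<ge> 1"
      and dt: "\<delta>t = T / real N\<^sub>t" and dx: "\<delta>x = D / real N\<^sub>x"
    for N\<^sub>t N\<^sub>x K n :: nat and m :: int and \<delta>t \<delta>x :: real
  proof -
    have dx_pos: "0 < \<delta>x" "\<delta>x \<le> D"
      using N D by (auto simp: dx field_simps)
    have x: "of_int m * \<delta>x \<le> D"
      using N D by (auto simp: dx field_simps)
    have "real n * \<delta>t \<in> {0..T}"
      using N T by (auto simp: dt field_simps)
    then interpret S: bounded_profile "\<phi> (real n * \<delta>t)" "pd_x \<phi> (real n * \<delta>t)"
      "pd_x (pd_x \<phi>) (real n * \<delta>t)" M "2 * D"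
      by (rule bounded_profile_slice)
    have grid: "grid_fun \<delta>t \<delta>x \<phi> n = (\<lambda>j. \<phi> (real n * \<delta>t) (of_int j * \<delta>x))"
      by (simp add: grid_fun_def fun_eq_iff)
    have x': "of_int m * \<delta>x \<le> 2 * D" "of_int (m + 1) * \<delta>x \<le> 2 * D"
      using x dx_pos D by (simp_all add: distrib_right)
    have *: "\<bar>local_error I v \<epsilon> \<eta> \<delta>t \<delta>x \<phi> n m\<bar>
        \<le> C * \<delta>t + C * \<delta>x powr (2/3) + C * (real K * \<delta>x) powr (-1/3)"
      if "\<bar>nonlocal (\<phi> (real n * \<delta>t)) (of_int m * \<delta>x)
          - I \<delta>x (\<lambda>j. \<phi> (real n * \<delta>t) (of_int j * \<delta>x)) m\<bar>
        \<le> 25 * M * (\<delta>x powr (2/3) + (real K * \<delta>x) powr (-1/3))" for I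
      using local_error_bound[of v \<epsilon> \<eta> N\<^sub>t N\<^sub>x n m \<delta>t \<delta>x I, OF _ _ _ N dt dx that[folded grid]] pos
      unfolding C_def[symmetric] distrib_left[of C] by simp
    show ?one
      by (rule *[of "nonlocal1 K", OF S.nonlocal1_error[OF dx_pos(1) K x'(1)]])
    show ?two
      by (rule *[of "nonlocal2 K", OF S.nonlocal2_error[OF dx_pos(1) K x'(2)]])
  qed
  \<comment> \<open>The remaining terms of the two claimed bounds are nonnegative, so adding them
    only weakens \<open>bounds\<close>.\<close>
  have nonneg: "0 \<le> C * (A powr p * \<delta>x)" "0 \<le> C * (A powr p * \<delta>x\<^sup>2)" "0 \<le> C * (A\<^sup>2 * \<delta>x ^ 3)"
    "0 \<le> C * (A * \<delta>x\<^sup>2)" if "0 \<le> \<delta>x" "0 \<le> A" for A \<delta>x p :: real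
    using C that by simp_all
  show ?thesis
  proof (intro conjI exI[of _ C] C allI impI)
    fix N\<^sub>t N\<^sub>x K n :: nat and m :: int
    assume N: "1 \<le> N\<^sub>t" "1 \<le> N\<^sub>x" and K: "1 \<le> K" and nm: "n \<le> N\<^sub>t" "0 \<le> m" "m \<le> int N\<^sub>x"
    have "0 \<le> D / real N\<^sub>x" "0 \<le> real K * (D / real N\<^sub>x)"
      using D by simp_all
    note b = bounds[OF N nm K refl refl] nonneg[OF this]
    show "let \<delta>t = T / real N\<^sub>t; \<delta>x = D / real N\<^sub>x; A = real K * \<delta>x in
        \<bar>local_error (nonlocal1 K) v \<epsilon> \<eta> \<delta>t \<delta>x \<phi> n m\<bar>
        \<le> C * \<delta>t + C * \<delta>x powr (2/3) + C * A powr (-1/3)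
          + C * (A powr (-1/3) * \<delta>x) + C * (A powr (2/3) * \<delta>x\<^sup>2)"
      unfolding Let_def by (rule add_increasing2, rule b, rule add_increasing2, rule b, rule b)
    show "let \<delta>t = T / real N\<^sub>t; \<delta>x = D / real N\<^sub>x; A = real K * \<delta>x in
        \<bar>local_error (nonlocal2 K) v \<epsilon> \<eta> \<delta>t \<delta>x \<phi> n m\<bar>
        \<le> C * \<delta>t + C * \<delta>x powr (2/3) + C * A powr (-1/3)
          + C * (A powr (-4/3) * \<delta>x) + C * (A\<^sup>2 * \<delta>x ^ 3) + C * (A * \<delta>x\<^sup>2)"
      unfolding Let_def by (rule add_increasing2, rule b, rule add_increasing2, rule b,
        rule add_increasing2, rule b, rule b)
  qed
qed

end
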